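(* Let $\mu$ be an adapted Borel probability measure on $\mathbb T$. (i) $P_\mu$ satisfies Doeblin's condition if and only if some convolution power $\mu^k$ ($k\ge 1$) is non-singular. (ii) $P_\mu$ satisfies Doeblin's condition if and only if $P_\mu^*$ does; i.e. $\|P_\mu^n-E\|_\infty\to 0$ if and only if $\|P_\mu^n-E\|_1\to 0$.
   Context: $\mathbb T$ is the unit circle group with Borel field $\mathcal B$ and normalized Lebesgue (Haar) measure $m$. For a Borel probability $\mu$ on $\mathbb T$, $P_\mu$ is the Markov operator $P_\mu f(x)=\int f(xy)\,\mu(dy)$, with transition probability $P(x,A)=\mu(Ax^{-1})$ and invariant probability $m$; it is a contraction of each $L_p(\mathbb T,m)$, $1\le p\le\infty$. Its dual Markov operator is $P_\mu^*=P_{\check\mu}$, where $\check\mu(A)=\mu(A^{-1})$, i.e. $P_\mu^* f=\mu*f$. $Ef=\int f\,dm$ is regarded as an operator (with constant-function values), and $\|\cdot\|_p$ of an operator is its operator norm on $L_p(\mathbb T,m)$. $P^{(n)}(x,A)=P^n1_A(x)$ is the $n$-step transition probability. Doeblin's condition for a Markov operator $P$ with invariant probability $m$: there exist $n\ge1$ and $\varepsilon\in(0,1)$ such that $m(A)<1-\varepsilon$ implies $\sup_x P^{(n)}(x,A)\le\varepsilon$; for the chains under consideration this is equivalent to $\|P^n-E\|_\infty\to0$ (Rosenblatt). $\mu$ is adapted if the closed subgroup generated by its support is $\mathbb T$. $\mu^k$ is the $k$-fold convolution power. A probability is non-singular if it is not singular with respect to $m$, i.e. its absolutely continuous part is non-zero.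 *)

theory Defs
  imports "HOL-Probability.Probability" "HOL-Algebra.Group"
begin

definition circle_group :: "complex monoid" where
  "circle_group = \<lparr>carrier = sphere 0 1, mult = (*), one = 1\<rparr>"

definition circle_borel :: "complex measure" where
  "circle_borel = restrict_space borel (sphere 0 1)"

definition haar :: "complex measure" where
  "haar = distr (uniform_measure lborel {0..<1::real}) circle_borel (\<lambda>t. cis (2 * pi * t))"

definition circle_prob :: "complex measure \<Rightarrow> bool" where
  "circle_prob \<mu> \<longleftrightarrow> prob_space \<mu> \<and> sets \<mu> = sets circle_borel"

definition supp :: "complex measure \<Rightarrow> complex set" where
  "supp \<mu> = {x \<in> sphere 0 1. \<forall>U. open U \<longrightarrow> x \<in> U \<longrightarrow> emeasure \<mu> (U \<inter> sphere 0 1) > 0}"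

definition adapted :: "complex measure \<Rightarrow> bool" where
  "adapted \<mu> \<longleftrightarrow> (\<lambda>H. subgroup H circle_group \<and> closed H) hull supp \<mu> = sphere 0 1"

definition conv :: "complex measure \<Rightarrow> complex measure \<Rightarrow> complex measure" where
  "conv \<mu> \<nu> = distr (\<mu> \<Otimes>\<^sub>M \<nu>) circle_borel (\<lambda>(x, y). x * y)"

primrec conv_power :: "complex measure \<Rightarrow> nat \<Rightarrow> complex measure" where
  "conv_power \<mu> 0 = return circle_borel 1"
| "conv_power \<mu> (Suc k) = conv \<mu> (conv_power \<mu> k)"

definition singular :: "complex measure \<Rightarrow> bool" where
  "singular \<mu> \<longleftrightarrow> (\<exists>N\<in>sets circle_borel. emeasure haar N = 0 \<and> emeasure \<mu> (sphere 0 1 - N) = 0)"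

definition nonsingular :: "complex measure \<Rightarrow> bool" where
  "nonsingular \<mu> \<longleftrightarrow> \<not> singular \<mu>"

text \<open>
  The operators act on functions rather than on classes modulo null sets. For \<open>f\<close> in
  \<open>L\<^sub>1(haar)\<close> the integral defining \<open>markov_op \<mu> f x\<close> exists for \<open>haar\<close>-almost every \<open>x\<close> (it is
  0 elsewhere), and changing \<open>f\<close> on a \<open>haar\<close>-null set changes \<open>markov_op \<mu> f\<close> only on a
  \<open>haar\<close>-null set. They are polymorphic in the scalars: transition probabilities use real
  functions, operator norms complex ones.
\<close>

definition markov_op :: "complex measure \<Rightarrow> (complex \<Rightarrow> 'b::{banach, second_countable_topology})
    \<Rightarrow> complex \<Rightarrow> 'b" where
  "markov_op \<mu> f = (\<lambda>x. \<integral>y. f (x * y) \<partial>\<mu>)"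

definition reflected :: "complex measure \<Rightarrow> complex measure" where
  "reflected \<mu> = distr \<mu> circle_borel inverse"

definition dual_markov_op :: "complex measure \<Rightarrow> (complex \<Rightarrow> 'b::{banach, second_countable_topology})
    \<Rightarrow> complex \<Rightarrow> 'b" where
  "dual_markov_op \<mu> = markov_op (reflected \<mu>)"

definition mean_op :: "(complex \<Rightarrow> 'b::{banach, second_countable_topology}) \<Rightarrow> complex \<Rightarrow> 'b" where
  "mean_op f = (\<lambda>x. \<integral>y. f y \<partial>haar)"

definition transition_prob ::
    "((complex \<Rightarrow> real) \<Rightarrow> complex \<Rightarrow> real) \<Rightarrow> nat \<Rightarrow> complex \<Rightarrow> complex set \<Rightarrow> real" where
  "transition_prob P n x A = (P ^^ n) (indicator A) x"

definition doeblin :: "((complex \<Rightarrow> real) \<Rightarrow> complex \<Rightarrow> real) \<Rightarrow> bool" where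
  "doeblin P \<longleftrightarrow> (\<exists>n\<ge>1. \<exists>\<epsilon>>0. \<epsilon> < 1 \<and>
     (\<forall>A\<in>sets circle_borel. measure haar A < 1 - \<epsilon> \<longrightarrow>
        (SUP x\<in>sphere 0 1. transition_prob P n x A) \<le> \<epsilon>))"

definition Lp_norm :: "ennreal \<Rightarrow> (complex \<Rightarrow> complex) \<Rightarrow> ennreal" where
  "Lp_norm p f =
     (if p = \<infinity> then esssup haar (\<lambda>x. ennreal (norm (f x)))
      else let I = (\<integral>\<^sup>+x. ennreal (norm (f x) powr enn2real p) \<partial>haar)
           in if I = \<infinity> then \<infinity> else ennreal (enn2real I powr (1 / enn2real p)))"

definition Lp_op_norm :: "ennreal \<Rightarrow> ((complex \<Rightarrow> complex) \<Rightarrow> complex \<Rightarrow> complex) \<Rightarrow> ennreal" where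
  "Lp_op_norm p T = (SUP f\<in>{f \<in> borel_measurable haar. Lp_norm p f \<le> 1}. Lp_norm p (T f))"

end

theory Submission
  imports Defs
begin

text \<open>
  Both parts come from one lower bound and one symmetry; write \<open>m\<close> for Haar measure.

  If some power \<open>\<mu>\<^sup>k\<close> is nonsingular, then some power dominates a positive multiple of \<open>m\<close> on the
  whole circle (\<open>nonsingular_power_imp_ge_haar\<close>). Indeed \<open>\<mu>\<^sup>k\<close> dominates a multiple of \<open>m\<close> restricted
  to a set of positive measure (Hahn decomposition, \<open>nonsingular_imp_ge_haar\<close>), and that set fills at
  least seven eighths of some arc. A self-convolution of Lebesgue measure on a set that fills so much
  of an interval dominates a multiple of Lebesgue measure on an interval longer by the factor \<open>5/4\<close>
  (\<open>minorized_on_double\<close>), since such a set meets each of its reflections about a point near the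
  centre of the interval in a set of definite measure. Repeated squaring therefore spreads the arc
  around the circle. Everything is computed on the real line, pulled back along the homomorphism
  \<open>t \<mapsto> exp (2 \<pi> i t)\<close>.

  Under a bound \<open>\<mu>\<^sup>n \<ge> c m\<close> every set of Haar measure greater than \<open>\<epsilon>\<close> is reached in \<open>n\<close> steps with
  probability at least \<open>c \<epsilon>\<close> from every starting point; applied to complements this is Doeblin's
  condition. Conversely a singular \<open>\<mu>\<^sup>n\<close> carries a null set with
  full \<open>n\<close>-step transition probability from \<open>1\<close>, so Doeblin's condition fails at \<open>n\<close>. The
  equivalence passes to the dual operator because inversion preserves \<open>m\<close> and commutes with taking
  convolution powers.

  For the operator norms, \<open>P\<^sup>n - E\<close> is symmetric for the bilinear form
  \<open>B(f, g) = \<integral> f(x) g(x\<^sup>-\<^sup>1) m(dx)\<close>, which pairs \<open>L\<^sub>1\<close> with \<open>L\<^sub>\<infinity>\<close>. Duality then gives equality of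
  the norms on \<open>L\<^sub>1\<close> and \<open>L\<^sub>\<infinity>\<close> for each \<open>n\<close> (\<open>op_norm_infinity_eq_1\<close>), hence the equivalence of the
  two convergences.
\<close>

section \<open>Haar measure as the image of Lebesgue measure\<close>

definition circle_map :: "real \<Rightarrow> complex" where
  "circle_map t = cis (2 * pi * t)"

lemma circle_map_add: "circle_map (s + t) = circle_map s * circle_map t"
  by (simp add: circle_map_def cis_mult distrib_left)

lemma circle_map_uminus: "circle_map (- t) = inverse (circle_map t)"
  by (simp add: circle_map_def)

lemma circle_map_of_int [simp]: "circle_map (of_int n) = 1"
  by (simp add: circle_map_def cis_multiple_2pi)

lemma circle_map_in_sphere [simp]: "circle_map t \<in> sphere 0 1"
  by (simp add: circle_map_def)

lemma circle_map_surj: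
  assumes "x \<in> sphere 0 1" shows "\<exists>t. x = circle_map t"
proof -
  have "x = cis (Arg x)" using assms
    by (metis cis_Arg dist_0_norm divide_self_if mem_sphere norm_zero sgn_div_norm scaleR_one inverse_1 zero_neq_one)
  then show ?thesis
    by (intro exI[of _ "Arg x / (2 * pi)"]) (simp add: circle_map_def)
qed

lemma space_circle_borel [simp]: "space circle_borel = sphere 0 1"
  by (simp add: circle_borel_def space_restrict_space)

lemma space_haar [simp]: "space haar = sphere 0 1"
  by (simp add: haar_def)

lemma sets_haar [simp, measurable_cong]: "sets haar = sets circle_borel"
  by (simp add: haar_def)

lemma sets_circle_borelD: "A \<in> sets circle_borel \<Longrightarrow> A \<subseteq> sphere 0 1"
  by (metis sets.sets_into_space space_circle_borel)

lemma measurable_circle_map [measurable]: "circle_map \<in> measurable borel circle_borel"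
  unfolding circle_borel_def
proof (rule measurable_restrict_space2)
  show "circle_map \<in> borel_measurable borel"
    unfolding circle_map_def
    by (intro borel_measurable_continuous_onI continuous_intros)
qed (auto simp: circle_map_def)

lemma measurable_circle_mult [measurable]:
  "(\<lambda>(x, y). x * y) \<in> measurable (circle_borel \<Otimes>\<^sub>M circle_borel) circle_borel"
  unfolding circle_borel_def
proof (rule measurable_restrict_space2)
  show "(\<lambda>(x::complex, y). x * y) \<in> space (restrict_space borel (sphere 0 1) \<Otimes>\<^sub>M restrict_space borel (sphere 0 1)) \<rightarrow> sphere 0 (1::real)"
    by (auto simp: space_pair_measure space_restrict_space norm_mult)
  have [measurable]: "(\<lambda>x. x) \<in> measurable (restrict_space borel (sphere 0 1)) (borel :: complex measure)"
    by (rule measurable_restrict_space1) simp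
  show "(\<lambda>(x::complex, y). x * y) \<in> borel_measurable (restrict_space borel (sphere 0 1) \<Otimes>\<^sub>M restrict_space borel (sphere 0 1))"
    by measurable
qed

lemma measurable_circle_inverse [measurable]:
  "inverse \<in> measurable circle_borel circle_borel"
  unfolding circle_borel_def
proof (rule measurable_restrict_space2)
  have "(\<lambda>x. x) \<in> measurable (restrict_space borel (sphere 0 1)) (borel :: complex measure)"
    by (rule measurable_restrict_space1) simp
  then show "inverse \<in> borel_measurable (restrict_space borel (sphere 0 (1::real)) :: complex measure)"
    by measurable
qed (auto simp: norm_inverse space_restrict_space)

lemma nn_integral_haar:
  assumes [measurable]: "f \<in> borel_measurable circle_borel"
  shows "(\<integral>\<^sup>+x. f x \<partial>haar) = (\<integral>\<^sup>+t. f (circle_map t) * indicator {0..<1} t \<partial>lborel)"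
proof -
  have "(\<lambda>t. cis (2 * pi * t)) = circle_map" by (simp add: circle_map_def fun_eq_iff)
  then have "(\<integral>\<^sup>+x. f x \<partial>haar) = (\<integral>\<^sup>+t. f (circle_map t) \<partial>uniform_measure lborel {0..<1})"
    by (simp add: haar_def nn_integral_distr)
  also have "\<dots> = (\<integral>\<^sup>+t. f (circle_map t) * indicator {0..<1} t \<partial>lborel)"
    by (subst nn_integral_uniform_measure) (auto simp: divide_ennreal_def)
  finally show ?thesis .
qed

lemma prob_space_haar: "prob_space haar"
  unfolding haar_def
proof (rule prob_space.prob_space_distr)
  show "prob_space (uniform_measure lborel {0..<1::real})"
    by (rule prob_space_uniform_measure) auto
  have "(\<lambda>t. cis (2 * pi * t)) = circle_map" by (simp add: circle_map_def fun_eq_iff)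
  then show "(\<lambda>t. cis (2 * pi * t)) \<in> measurable (uniform_measure lborel {0..<1::real}) circle_borel"
    by simp
qed

lemma nn_integral_lborel_shift:
  fixes h :: "real \<Rightarrow> ennreal"
  assumes [measurable]: "h \<in> borel_measurable borel"
  shows "(\<integral>\<^sup>+t. h (s + t) \<partial>lborel) = (\<integral>\<^sup>+t. h t \<partial>lborel)"
  using nn_integral_real_affine[of h 1 s] by simp

lemma nn_integral_periodic:
  fixes h :: "real \<Rightarrow> ennreal"
  assumes [measurable]: "h \<in> borel_measurable borel" and per: "\<And>t n. h (of_int n + t) = h t"
  shows "(\<integral>\<^sup>+t. h t * indicator {a..<a+1} t \<partial>lborel) = (\<integral>\<^sup>+t. h t * indicator {0..<1} t \<partial>lborel)"
proof -
  define n where "n = \<lfloor>a\<rfloor>"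
  have n: "real_of_int n \<le> a" "a < real_of_int n + 1" unfolding n_def by linarith+
  let ?r = "a - of_int n"
  have "(\<integral>\<^sup>+t. h t * indicator {a..<a+1} t \<partial>lborel)
      = (\<integral>\<^sup>+t. h t * indicator {a..<of_int n + 1} t + h t * indicator {of_int n + 1..<a + 1} t \<partial>lborel)"
    using n by (intro nn_integral_cong) (auto split: split_indicator)
  also have "\<dots> = (\<integral>\<^sup>+t. h t * indicator {a..<of_int n + 1} t \<partial>lborel) + (\<integral>\<^sup>+t. h t * indicator {of_int n + 1..<a + 1} t \<partial>lborel)"
    by (intro nn_integral_add) auto
  also have "(\<integral>\<^sup>+t. h t * indicator {a..<of_int n + 1} t \<partial>lborel) = (\<integral>\<^sup>+t. h t * indicator {?r..<1} t \<partial>lborel)"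
    by (subst nn_integral_lborel_shift[symmetric, of _ "of_int n"])
       (auto intro!: nn_integral_cong simp: per split: split_indicator)
  also have "(\<integral>\<^sup>+t. h t * indicator {of_int n + 1..<a + 1} t \<partial>lborel) = (\<integral>\<^sup>+t. h t * indicator {0..<?r} t \<partial>lborel)"
    using per[of "n + 1"]
    by (subst nn_integral_lborel_shift[symmetric, of _ "of_int (n + 1)"])
       (auto intro!: nn_integral_cong split: split_indicator)
  also have "(\<integral>\<^sup>+t. h t * indicator {?r..<1} t \<partial>lborel) + (\<integral>\<^sup>+t. h t * indicator {0..<?r} t \<partial>lborel)
     = (\<integral>\<^sup>+t. h t * indicator {?r..<1} t + h t * indicator {0..<?r} t \<partial>lborel)"
    by (intro nn_integral_add[symmetric]) auto
  also have "\<dots> = (\<integral>\<^sup>+t. h t * indicator {0..<1} t \<partial>lborel)"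
    using n by (intro nn_integral_cong) (auto split: split_indicator)
  finally show ?thesis .
qed

lemma measurable_circle_mult_left [measurable]:
  assumes "x \<in> sphere 0 1" shows "(\<lambda>y. x * y) \<in> measurable circle_borel circle_borel"
  using measurable_compose[OF measurable_Pair1'[of x circle_borel circle_borel] measurable_circle_mult] assms by simp

text \<open>
  Under \<open>circle_map\<close> a rotation becomes a shift of the unit interval, which does not change the
  integral of a periodic function.
\<close>

lemma nn_integral_haar_translate:
  assumes [measurable]: "f \<in> borel_measurable circle_borel" and x: "x \<in> sphere 0 1"
  shows "(\<integral>\<^sup>+y. f (x * y) \<partial>haar) = (\<integral>\<^sup>+y. f y \<partial>haar)"
proof -
  obtain s where s: "x = circle_map s" using circle_map_surj[OF x] by blast
  have [measurable]: "(\<lambda>y. x * y) \<in> measurable circle_borel circle_borel"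
    by (rule measurable_circle_mult_left[OF x])
  have "(\<integral>\<^sup>+y. f (x * y) \<partial>haar) = (\<integral>\<^sup>+t. f (circle_map (s + t)) * indicator {0..<1} t \<partial>lborel)"
    by (subst nn_integral_haar) (auto simp: s circle_map_add)
  also have "\<dots> = (\<integral>\<^sup>+t. f (circle_map t) * indicator {s..<s+1} t \<partial>lborel)"
    by (subst (2) nn_integral_lborel_shift[symmetric, of _ s])
       (auto intro!: nn_integral_cong split: split_indicator)
  also have "\<dots> = (\<integral>\<^sup>+y. f y \<partial>haar)"
    by (subst nn_integral_periodic) (auto simp: nn_integral_haar circle_map_add)
  finally show ?thesis .
qed

lemma distr_haar_mult:
  assumes x: "x \<in> sphere 0 1"
  shows "distr haar circle_borel (\<lambda>y. x * y) = haar"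
proof (rule measure_eqI)
  fix A assume A: "A \<in> sets (distr haar circle_borel (\<lambda>y. x * y))"
  note [measurable] = measurable_circle_mult_left[OF x]
  have [measurable]: "A \<in> sets circle_borel" using A by simp
  have "emeasure (distr haar circle_borel (\<lambda>y. x * y)) A = (\<integral>\<^sup>+y. indicator A y \<partial>distr haar circle_borel (\<lambda>y. x * y))"
    by simp
  also have "\<dots> = (\<integral>\<^sup>+y. indicator A (x * y) \<partial>haar)"
    by (subst nn_integral_distr) auto
  also have "\<dots> = emeasure haar A"
    by (subst nn_integral_haar_translate[OF _ x]) auto
  finally show "emeasure (distr haar circle_borel (\<lambda>y. x * y)) A = emeasure haar A" .
qed simp

lemma distr_haar_inverse: "distr haar circle_borel inverse = haar"
proof (rule measure_eqI)
  fix A assume A: "A \<in> sets (distr haar circle_borel inverse)"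
  have [measurable]: "A \<in> sets circle_borel" using A by simp
  let ?h = "\<lambda>t. indicator A (circle_map t) :: ennreal"
  have "emeasure (distr haar circle_borel inverse) A = (\<integral>\<^sup>+y. indicator A y \<partial>distr haar circle_borel inverse)"
    by simp
  also have "\<dots> = (\<integral>\<^sup>+y. indicator A (inverse y) \<partial>haar)"
    by (subst nn_integral_distr) auto
  also have "\<dots> = (\<integral>\<^sup>+t. ?h (- t) * indicator {0..<1} t \<partial>lborel)"
    by (subst nn_integral_haar) (auto simp: circle_map_uminus)
  also have "\<dots> = (\<integral>\<^sup>+t. ?h t * indicator {-1<..0} t \<partial>lborel)"
    by (subst (2) nn_integral_real_affine[where c="-1" and t=0])
       (auto intro!: nn_integral_cong split: split_indicator)
  also have "\<dots> = (\<integral>\<^sup>+t. ?h t * indicator {-1..<-1+1} t \<partial>lborel)"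
    using AE_lborel_singleton[of "0::real"] AE_lborel_singleton[of "-1::real"]
    by (intro nn_integral_cong_AE) (auto split: split_indicator)
  also have "\<dots> = emeasure haar A"
    by (subst nn_integral_periodic) (auto simp: nn_integral_haar[symmetric] circle_map_add)
  finally show "emeasure (distr haar circle_borel inverse) A = emeasure haar A" .
qed simp

section \<open>Convolution powers, reflection and transition probabilities\<close>

lemma circle_probD:
  assumes "circle_prob \<mu>"
  shows "prob_space \<mu>" "sets \<mu> = sets circle_borel" "space \<mu> = sphere 0 1"
  using assms sets_eq_imp_space_eq[of \<mu> circle_borel] by (auto simp: circle_prob_def)

lemma circle_prob_distr:
  assumes "circle_prob \<mu>" "h \<in> measurable circle_borel circle_borel"
  shows "circle_prob (distr \<mu> circle_borel h)"
  using assms prob_space.prob_space_distr[of \<mu> h circle_borel]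
    measurable_cong_sets[of \<mu> circle_borel circle_borel circle_borel]
  by (simp add: circle_prob_def)

lemma circle_prob_reflected: "circle_prob \<mu> \<Longrightarrow> circle_prob (reflected \<mu>)"
  unfolding reflected_def by (rule circle_prob_distr) auto

lemma measurable_conv_map:
  assumes "circle_prob \<mu>" "circle_prob \<nu>"
  shows "(\<lambda>(x, y). x * y) \<in> measurable (\<mu> \<Otimes>\<^sub>M \<nu>) circle_borel"
proof -
  have "sets (\<mu> \<Otimes>\<^sub>M \<nu>) = sets (circle_borel \<Otimes>\<^sub>M circle_borel)"
    using circle_probD(2)[OF assms(1)] circle_probD(2)[OF assms(2)] by (rule sets_pair_measure_cong)
  then show ?thesis
    using measurable_circle_mult measurable_cong_sets by blast
qed

lemma circle_prob_conv:
  assumes "circle_prob \<mu>" "circle_prob \<nu>" shows "circle_prob (conv \<mu> \<nu>)"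
proof -
  interpret M: prob_space \<mu> by (rule circle_probD[OF assms(1)])
  interpret N: prob_space \<nu> by (rule circle_probD[OF assms(2)])
  interpret P: pair_prob_space \<mu> \<nu> ..
  show ?thesis
    unfolding circle_prob_def conv_def
    using P.prob_space_distr[OF measurable_conv_map[OF assms]] by simp
qed

lemma circle_prob_conv_power:
  assumes "circle_prob \<mu>" shows "circle_prob (conv_power \<mu> n)"
  by (induction n) (auto simp: circle_prob_conv assms, simp add: circle_prob_def prob_space_return)

lemma nn_integral_conv:
  assumes "circle_prob \<mu>" "circle_prob \<nu>" and f: "f \<in> borel_measurable circle_borel"
  shows "(\<integral>\<^sup>+z. f z \<partial>conv \<mu> \<nu>) = (\<integral>\<^sup>+x. \<integral>\<^sup>+y. f (x * y) \<partial>\<nu> \<partial>\<mu>)"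
proof -
  interpret N: prob_space \<nu> by (rule circle_probD[OF assms(2)])
  note [measurable] = measurable_conv_map[OF assms(1,2)] f
  have "(\<integral>\<^sup>+z. f z \<partial>conv \<mu> \<nu>) = (\<integral>\<^sup>+p. f (case p of (x, y) \<Rightarrow> x * y) \<partial>(\<mu> \<Otimes>\<^sub>M \<nu>))"
    unfolding conv_def by (rule nn_integral_distr) measurable
  also have "\<dots> = (\<integral>\<^sup>+x. \<integral>\<^sup>+y. f (x * y) \<partial>\<nu> \<partial>\<mu>)"
    by (subst N.nn_integral_fst[symmetric]) auto
  finally show ?thesis .
qed

lemma measurable_circle_joint:
  assumes \<nu>: "circle_prob \<nu>" and f: "f \<in> measurable circle_borel N"
  shows "(\<lambda>(x, y). f (x * y)) \<in> measurable (circle_borel \<Otimes>\<^sub>M \<nu>) N"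
proof -
  have "sets (circle_borel \<Otimes>\<^sub>M \<nu>) = sets (circle_borel \<Otimes>\<^sub>M circle_borel)"
    using circle_probD(2)[OF \<nu>] by (intro sets_pair_measure_cong) auto
  moreover have "(\<lambda>(x, y). f (x * y)) \<in> measurable (circle_borel \<Otimes>\<^sub>M circle_borel) N"
    using measurable_compose[OF measurable_circle_mult f] by (simp add: case_prod_beta')
  ultimately show ?thesis using measurable_cong_sets by blast
qed

lemma borel_measurable_nn_integral_translate:
  assumes \<nu>: "circle_prob \<nu>" and f: "f \<in> borel_measurable circle_borel"
  shows "(\<lambda>x. \<integral>\<^sup>+y. f (x * y) \<partial>\<nu>) \<in> borel_measurable circle_borel"
proof -
  interpret N: prob_space \<nu> by (rule circle_probD[OF \<nu>])
  show ?thesis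
    using measurable_circle_joint[OF assms] by measurable
qed

text \<open>
  The law of exponents \<open>\<mu>\<^sup>m\<^sup>+\<^sup>n = \<mu>\<^sup>m * \<mu>\<^sup>n\<close>, in the form needed for estimating a power from below.
\<close>

lemma nn_integral_conv_power_add:
  assumes \<mu>: "circle_prob \<mu>" and f: "f \<in> borel_measurable circle_borel"
  shows "(\<integral>\<^sup>+z. f z \<partial>conv_power \<mu> (m + n)) = (\<integral>\<^sup>+x. \<integral>\<^sup>+y. f (x * y) \<partial>conv_power \<mu> n \<partial>conv_power \<mu> m)"
  using f
proof (induction m arbitrary: f)
  case 0
  have "(\<integral>\<^sup>+x. \<integral>\<^sup>+y. f (x * y) \<partial>conv_power \<mu> n \<partial>return circle_borel 1) = (\<integral>\<^sup>+y. f (1 * y) \<partial>conv_power \<mu> n)"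
    by (intro nn_integral_return borel_measurable_nn_integral_translate circle_prob_conv_power \<mu> 0) auto
  then show ?case by simp
next
  case (Suc m)
  note P = circle_prob_conv_power[OF \<mu>]
  have "(\<integral>\<^sup>+z. f z \<partial>conv_power \<mu> (Suc m + n)) = (\<integral>\<^sup>+w. \<integral>\<^sup>+z. f (w * z) \<partial>conv_power \<mu> (m + n) \<partial>\<mu>)"
    using nn_integral_conv[OF \<mu> P Suc.prems] by simp
  also have "\<dots> = (\<integral>\<^sup>+w. \<integral>\<^sup>+x. \<integral>\<^sup>+y. f (w * (x * y)) \<partial>conv_power \<mu> n \<partial>conv_power \<mu> m \<partial>\<mu>)"
    by (intro nn_integral_cong Suc.IH measurable_compose[OF measurable_circle_mult_left Suc.prems])
       (simp add: circle_probD[OF \<mu>])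
  also have "\<dots> = (\<integral>\<^sup>+x. \<integral>\<^sup>+y. f (x * y) \<partial>conv_power \<mu> n \<partial>conv_power \<mu> (Suc m))"
    using nn_integral_conv[OF \<mu> P borel_measurable_nn_integral_translate[OF P Suc.prems]]
    by (simp add: mult.assoc)
  finally show ?case .
qed

lemma nn_integral_reflected:
  assumes \<mu>: "circle_prob \<mu>" and [measurable]: "f \<in> borel_measurable circle_borel"
  shows "(\<integral>\<^sup>+x. f x \<partial>reflected \<mu>) = (\<integral>\<^sup>+x. f (inverse x) \<partial>\<mu>)"
proof -
  note [measurable_cong] = circle_probD(2)[OF \<mu>]
  show ?thesis unfolding reflected_def by (rule nn_integral_distr) auto
qed

text \<open>
  Since the circle is abelian, inversion is a homomorphism, so reflecting commutes with convolution.
\<close>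

lemma nn_integral_conv_power_reflected:
  assumes \<mu>: "circle_prob \<mu>" and f: "f \<in> borel_measurable circle_borel"
  shows "(\<integral>\<^sup>+x. f x \<partial>conv_power (reflected \<mu>) n) = (\<integral>\<^sup>+x. f (inverse x) \<partial>conv_power \<mu> n)"
  using f
proof (induction n arbitrary: f)
  case 0
  note [measurable] = 0
  have "(\<integral>\<^sup>+x. f (inverse x) \<partial>return circle_borel 1) = f (inverse 1)"
    by (intro nn_integral_return) auto
  moreover have "(\<integral>\<^sup>+x. f x \<partial>return circle_borel 1) = f 1"
    by (intro nn_integral_return) auto
  ultimately show ?case by simp
next
  case (Suc n)
  note [measurable] = Suc.prems
  note R = circle_prob_reflected[OF \<mu>]
  note P = circle_prob_conv_power
  have "(\<integral>\<^sup>+x. f x \<partial>conv_power (reflected \<mu>) (Suc n)) = (\<integral>\<^sup>+x. \<integral>\<^sup>+y. f (x * y) \<partial>conv_power (reflected \<mu>) n \<partial>reflected \<mu>)"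
    using nn_integral_conv[OF R P[OF R] Suc.prems] by simp
  also have "\<dots> = (\<integral>\<^sup>+x. \<integral>\<^sup>+y. f (inverse x * y) \<partial>conv_power (reflected \<mu>) n \<partial>\<mu>)"
    by (rule nn_integral_reflected[OF \<mu> borel_measurable_nn_integral_translate[OF P[OF R] Suc.prems]])
  also have "\<dots> = (\<integral>\<^sup>+x. \<integral>\<^sup>+y. f (inverse x * inverse y) \<partial>conv_power \<mu> n \<partial>\<mu>)"
  proof (rule nn_integral_cong)
    fix x assume "x \<in> space \<mu>"
    then have "inverse x \<in> sphere 0 1" by (simp add: circle_probD[OF \<mu>] norm_inverse)
    from measurable_compose[OF measurable_circle_mult_left[OF this] Suc.prems]
    show "(\<integral>\<^sup>+y. f (inverse x * y) \<partial>conv_power (reflected \<mu>) n) = (\<integral>\<^sup>+y. f (inverse x * inverse y) \<partial>conv_power \<mu> n)"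
      by (rule Suc.IH)
  qed
  also have "\<dots> = (\<integral>\<^sup>+x. f (inverse x) \<partial>conv_power \<mu> (Suc n))"
    using nn_integral_conv[OF \<mu> P[OF \<mu>], of "\<lambda>x. f (inverse x)"] by (simp add: mult.commute)
  finally show ?case .
qed

lemma emeasure_conv_power_reflected:
  assumes \<mu>: "circle_prob \<mu>" and [measurable]: "A \<in> sets circle_borel"
  shows "emeasure (conv_power (reflected \<mu>) n) A = emeasure (conv_power \<mu> n) (inverse -` A \<inter> sphere 0 1)"
proof -
  note P = circle_prob_conv_power
  have [simp]: "A \<in> sets (conv_power (reflected \<mu>) n)"
    using circle_probD(2)[OF P[OF circle_prob_reflected[OF \<mu>]]] by simp
  have "inverse -` A \<inter> space circle_borel \<in> sets circle_borel" by measurable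
  then have [simp]: "inverse -` A \<inter> sphere 0 1 \<in> sets (conv_power \<mu> n)"
    using circle_probD(2)[OF P[OF \<mu>]] by simp
  have "emeasure (conv_power (reflected \<mu>) n) A = (\<integral>\<^sup>+x. indicator A (inverse x) \<partial>conv_power \<mu> n)"
    by (subst nn_integral_conv_power_reflected[OF \<mu>, symmetric]) auto
  also have "\<dots> = (\<integral>\<^sup>+x. indicator (inverse -` A \<inter> sphere 0 1) x \<partial>conv_power \<mu> n)"
    using circle_probD(3)[OF P[OF \<mu>]] by (intro nn_integral_cong) (auto split: split_indicator)
  finally show ?thesis by simp
qed

lemma singular_conv_power_reflected:
  assumes \<mu>: "circle_prob \<mu>" and s: "singular (conv_power \<mu> n)"
  shows "singular (conv_power (reflected \<mu>) n)"
proof -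
  from s obtain N where N [measurable]: "N \<in> sets circle_borel" and N0: "emeasure haar N = 0"
    and N1: "emeasure (conv_power \<mu> n) (sphere 0 1 - N) = 0" by (auto simp: singular_def)
  let ?N = "inverse -` N \<inter> sphere 0 1"
  have "inverse -` N \<inter> space circle_borel \<in> sets circle_borel" by measurable
  then have [measurable]: "?N \<in> sets circle_borel" by simp
  have "emeasure haar ?N = emeasure (distr haar circle_borel inverse) N"
    by (subst emeasure_distr) auto
  then have "emeasure haar ?N = 0" using N0 by (simp add: distr_haar_inverse)
  moreover have "emeasure (conv_power (reflected \<mu>) n) (sphere 0 1 - ?N) = 0"
  proof -
    have "sphere 0 1 - ?N = space circle_borel - ?N" by simp
    then have "sphere 0 1 - ?N \<in> sets circle_borel" by (metis sets.compl_sets \<open>?N \<in> sets circle_borel\<close>)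
    moreover have "inverse -` (sphere 0 1 - ?N) \<inter> sphere 0 1 = sphere 0 1 - N"
      by (auto simp: norm_inverse)
    ultimately show ?thesis using N1 emeasure_conv_power_reflected[OF \<mu>] by simp
  qed
  ultimately show ?thesis using \<open>?N \<in> sets circle_borel\<close> unfolding singular_def by blast
qed

lemma reflected_reflected:
  assumes \<mu>: "circle_prob \<mu>" shows "reflected (reflected \<mu>) = \<mu>"
proof -
  note [measurable_cong] = circle_probD(2)[OF \<mu>]
  have "reflected (reflected \<mu>) = distr \<mu> circle_borel (inverse \<circ> inverse)"
    unfolding reflected_def by (rule distr_distr) auto
  also have "\<dots> = distr \<mu> \<mu> (\<lambda>x. x)"
    by (rule distr_cong) (auto simp: circle_probD[OF \<mu>])
  finally show ?thesis by simp
qed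

lemma singular_conv_power_reflected_iff:
  assumes \<mu>: "circle_prob \<mu>"
  shows "singular (conv_power (reflected \<mu>) n) \<longleftrightarrow> singular (conv_power \<mu> n)"
  using singular_conv_power_reflected[OF \<mu>] singular_conv_power_reflected[OF circle_prob_reflected[OF \<mu>]]
  by (auto simp: reflected_reflected[OF \<mu>])

lemma integral_conv:
  fixes f :: "complex \<Rightarrow> real"
  assumes "circle_prob \<mu>" "circle_prob \<nu>" and f: "f \<in> borel_measurable circle_borel"
    and b: "\<And>z. z \<in> sphere 0 1 \<Longrightarrow> \<bar>f z\<bar> \<le> B"
  shows "(\<integral>z. f z \<partial>conv \<mu> \<nu>) = (\<integral>x. \<integral>y. f (x * y) \<partial>\<nu> \<partial>\<mu>)"
proof -
  interpret M: prob_space \<mu> by (rule circle_probD[OF assms(1)])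
  interpret N: prob_space \<nu> by (rule circle_probD[OF assms(2)])
  interpret P: pair_prob_space \<mu> \<nu> ..
  note [measurable] = measurable_conv_map[OF assms(1,2)] f
  have "(\<integral>z. f z \<partial>conv \<mu> \<nu>) = (\<integral>p. f (case p of (x, y) \<Rightarrow> x * y) \<partial>(\<mu> \<Otimes>\<^sub>M \<nu>))"
    unfolding conv_def by (rule integral_distr) measurable
  also have "\<dots> = (\<integral>x. \<integral>y. f (x * y) \<partial>\<nu> \<partial>\<mu>)"
  proof (subst P.integral_fst'[symmetric])
    show "integrable (\<mu> \<Otimes>\<^sub>M \<nu>) (\<lambda>p. f (case p of (x, y) \<Rightarrow> x * y))"
      by (rule P.P.integrable_const_bound[of _ B])
         (auto intro!: AE_I2 b simp: space_pair_measure circle_probD[OF assms(1)] circle_probD[OF assms(2)] norm_mult)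
  qed simp
  finally show ?thesis .
qed

lemma markov_op_power_indicator:
  assumes \<mu>: "circle_prob \<mu>" and A: "A \<in> sets circle_borel" and x: "x \<in> sphere 0 1"
  shows "(markov_op \<mu> ^^ n) (indicator A :: complex \<Rightarrow> real) x = (\<integral>y. indicator A (x * y) \<partial>conv_power \<mu> n)"
  using x
proof (induction n arbitrary: x)
  case 0
  have "(\<lambda>y. indicator A (x * y) :: real) \<in> borel_measurable circle_borel"
    using measurable_compose[OF measurable_circle_mult_left[OF 0] borel_measurable_indicator[OF A]] .
  then have "(\<integral>y. indicator A (x * y) \<partial>return circle_borel 1) = (indicator A (x * 1) :: real)"
    by (intro integral_return) auto
  then show ?case by simp
next
  case (Suc n)
  have m: "(\<lambda>y. indicator A (x * y) :: real) \<in> borel_measurable circle_borel"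
    using measurable_compose[OF measurable_circle_mult_left[OF Suc.prems] borel_measurable_indicator[OF A]] .
  have "(markov_op \<mu> ^^ Suc n) (indicator A :: complex \<Rightarrow> real) x = (\<integral>w. (markov_op \<mu> ^^ n) (indicator A) (x * w) \<partial>\<mu>)"
    by (simp add: markov_op_def)
  also have "\<dots> = (\<integral>w. \<integral>y. indicator A (x * w * y) \<partial>conv_power \<mu> n \<partial>\<mu>)"
    using Suc.prems by (intro Bochner_Integration.integral_cong Suc.IH) (auto simp: circle_probD[OF \<mu>] norm_mult)
  also have "\<dots> = (\<integral>y. indicator A (x * y) \<partial>conv_power \<mu> (Suc n))"
    using integral_conv[OF \<mu> circle_prob_conv_power[OF \<mu>] m, of 1] by (simp add: mult.assoc indicator_def)
  finally show ?case .
qed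

lemma vimage_translate_in_sets:
  assumes "A \<in> sets circle_borel" "x \<in> sphere 0 1"
  shows "{y \<in> sphere 0 1. x * y \<in> A} \<in> sets circle_borel"
  using measurable_sets[OF measurable_circle_mult_left[OF assms(2)] assms(1)]
  by (auto simp: vimage_def Int_def conj_commute)

lemma transition_prob_markov_op:
  assumes \<mu>: "circle_prob \<mu>" and A: "A \<in> sets circle_borel" and x: "x \<in> sphere 0 1"
  shows "transition_prob (markov_op \<mu>) n x A = measure (conv_power \<mu> n) {y \<in> sphere 0 1. x * y \<in> A}"
proof -
  let ?S = "{y \<in> sphere 0 1. x * y \<in> A}"
  note P = circle_probD[OF circle_prob_conv_power[OF \<mu>, of n]]
  have "(\<integral>y. indicator A (x * y) \<partial>conv_power \<mu> n) = (\<integral>y. indicator ?S y \<partial>conv_power \<mu> n :: real)"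
    by (intro Bochner_Integration.integral_cong) (auto simp: P indicator_def)
  also have "\<dots> = measure (conv_power \<mu> n) ?S"
    using vimage_translate_in_sets[OF A x] P by (simp add: Int_absorb2 subset_eq)
  finally show ?thesis
    by (simp add: transition_prob_def markov_op_power_indicator[OF assms])
qed

lemma measure_haar_translate:
  assumes A: "A \<in> sets circle_borel" and x: "x \<in> sphere 0 1"
  shows "measure haar {y \<in> sphere 0 1. x * y \<in> A} = measure haar A"
proof -
  have "measure (distr haar circle_borel (\<lambda>y. x * y)) A = measure haar ((\<lambda>y. x * y) -` A \<inter> space haar)"
    using A measurable_circle_mult_left[OF x] by (intro measure_distr) auto
  then show ?thesis
    by (simp add: distr_haar_mult[OF x] vimage_def Int_def conj_commute)
qed

section \<open>From a nonsingular measure to a piece of an arc\<close>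

text \<open>
  \<open>\<nu>\<close> dominates a positive multiple of the image under \<open>circle_map\<close> of Lebesgue measure on \<open>A\<close>. The
  set \<open>A\<close> lives on the line and may be longer than a period: arcs can then be added and enlarged
  as intervals, without wrapping around. Test functions take the place of sets because they are what
  the iterated integrals of a convolution require.
\<close>

definition minorized_on :: "complex measure \<Rightarrow> real set \<Rightarrow> bool" where
  "minorized_on \<nu> A \<longleftrightarrow> (\<exists>c>0. \<forall>f\<in>borel_measurable circle_borel.
     ennreal c * (\<integral>\<^sup>+t. f (circle_map t) * indicator A t \<partial>lborel) \<le> (\<integral>\<^sup>+x. f x \<partial>\<nu>))"

lemma minorized_on_subset:
  assumes "minorized_on \<nu> A" "B \<subseteq> A" shows "minorized_on \<nu> B"
proof -
  obtain c where "c > 0" and c: "\<And>f. f \<in> borel_measurable circle_borel \<Longrightarrow>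
     ennreal c * (\<integral>\<^sup>+t. f (circle_map t) * indicator A t \<partial>lborel) \<le> (\<integral>\<^sup>+x. f x \<partial>\<nu>)"
    using assms(1) by (auto simp: minorized_on_def)
  have "ennreal c * (\<integral>\<^sup>+t. f (circle_map t) * indicator B t \<partial>lborel)
      \<le> ennreal c * (\<integral>\<^sup>+t. f (circle_map t) * indicator A t \<partial>lborel)" for f :: "complex \<Rightarrow> ennreal"
    using assms(2) by (intro mult_left_mono nn_integral_mono) (auto split: split_indicator)
  with c \<open>c > 0\<close> show ?thesis
    unfolding minorized_on_def by (meson order_trans)
qed

text \<open>
  For each \<open>j\<close> let \<open>Y j\<close> be a positive set of the signed measure \<open>\<nu> - c j * haar\<close>, where
  \<open>c j\<close> tends to \<open>0\<close>. If all of them were null, so would be their union \<open>N\<close>, while \<open>\<nu>\<close> gives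
  the complement of \<open>N\<close> mass at most \<open>c j\<close> for every \<open>j\<close>; then \<open>\<nu>\<close> would be singular.
\<close>

lemma nonsingular_imp_ge_haar:
  assumes \<nu>: "circle_prob \<nu>" and ns: "nonsingular \<nu>"
  obtains Y c where "Y \<in> sets circle_borel" "emeasure haar Y > 0" "c > 0"
    "\<And>X. X \<in> sets circle_borel \<Longrightarrow> X \<subseteq> Y \<Longrightarrow> ennreal c * emeasure haar X \<le> emeasure \<nu> X"
proof -
  interpret N: prob_space \<nu> by (rule circle_probD[OF \<nu>])
  interpret H: prob_space haar by (rule prob_space_haar)
  define c where "c j = 1 / real (Suc j)" for j
  have c0: "c j > 0" for j by (simp add: c_def)
  have "\<exists>Y\<in>sets \<nu>. (\<forall>X\<in>sets \<nu>. X \<subseteq> Y \<longrightarrow> emeasure (scale_measure (ennreal (c j)) haar) X \<le> emeasure \<nu> X) \<and>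
      (\<forall>X\<in>sets \<nu>. X \<inter> Y = {} \<longrightarrow> emeasure \<nu> X \<le> emeasure (scale_measure (ennreal (c j)) haar) X)" for j
    by (rule finite_unsigned_Hahn_decomposition)
       (auto simp: circle_probD[OF \<nu>] N.finite_measure_axioms ennreal_mult_eq_top_iff intro!: finite_measureI)
  then obtain Y where Y: "\<And>j. Y j \<in> sets circle_borel"
    and lo: "\<And>j X. X \<in> sets circle_borel \<Longrightarrow> X \<subseteq> Y j \<Longrightarrow> ennreal (c j) * emeasure haar X \<le> emeasure \<nu> X"
    and hi: "\<And>j X. X \<in> sets circle_borel \<Longrightarrow> X \<inter> Y j = {} \<Longrightarrow> emeasure \<nu> X \<le> ennreal (c j) * emeasure haar X"
    by (simp add: circle_probD[OF \<nu>]) metis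
  have "\<exists>j. emeasure haar (Y j) > 0"
  proof (rule ccontr)
    assume "\<not> ?thesis"
    then have Y0: "emeasure haar (Y j) = 0" for j by (simp add: zero_less_iff_neq_zero)
    let ?N = "\<Union>j. Y j"
    have N: "?N \<in> sets circle_borel" using Y by auto
    have Nc: "sphere 0 1 - ?N \<in> sets circle_borel"
      using sets.compl_sets[OF N] by simp
    have "?N \<in> null_sets haar" by (rule null_sets_UN) (use Y Y0 in auto)
    moreover have "emeasure \<nu> (sphere 0 1 - ?N) = 0"
    proof -
      have le: "emeasure \<nu> (sphere 0 1 - ?N) \<le> ennreal (c j)" for j
      proof -
        have "emeasure \<nu> (sphere 0 1 - ?N) \<le> ennreal (c j) * emeasure haar (sphere 0 1 - ?N)"
          by (rule hi[OF Nc]) auto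
        also have "\<dots> \<le> ennreal (c j) * 1" by (intro mult_left_mono H.measure_le_1) auto
        finally show ?thesis by simp
      qed
      have "(\<lambda>j. ennreal (c j)) \<longlonglongrightarrow> ennreal 0"
        unfolding c_def by (intro tendsto_ennrealI LIMSEQ_Suc lim_1_over_n)
      from LIMSEQ_le_const[OF this, of "emeasure \<nu> (sphere 0 1 - ?N)"] le show ?thesis by simp
    qed
    ultimately have "singular \<nu>" using N unfolding singular_def by (auto simp: null_sets_def)
    with ns show False by (simp add: nonsingular_def)
  qed
  then obtain j where "emeasure haar (Y j) > 0" by blast
  from that[OF Y this c0[of j] lo] show thesis by blast
qed

lemma nonsingular_imp_minorized_on:
  assumes \<nu>: "circle_prob \<nu>" and ns: "nonsingular \<nu>"
  obtains A where "A \<in> sets borel" "A \<subseteq> {0..<1}" "emeasure lborel A > 0" "minorized_on \<nu> A"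
proof -
  from nonsingular_imp_ge_haar[OF assms] obtain Y c where Y [measurable]: "Y \<in> sets circle_borel"
    and pos: "emeasure haar Y > 0" and c: "c > 0"
    and le: "\<And>X. X \<in> sets circle_borel \<Longrightarrow> X \<subseteq> Y \<Longrightarrow> ennreal c * emeasure haar X \<le> emeasure \<nu> X" by blast
  define A where "A = circle_map -` Y \<inter> {0..<1}"
  have "circle_map -` Y \<inter> space borel \<in> sets borel" by measurable
  then have A [measurable]: "A \<in> sets borel" by (simp add: A_def)
  have ind: "indicator Y (circle_map t) * indicator {0..<1} t = (indicator A t :: ennreal)" for t
    by (auto simp: A_def split: split_indicator)
  have "emeasure lborel A = (\<integral>\<^sup>+t. indicator Y (circle_map t) * indicator {0..<1} t \<partial>lborel)"
    by (simp add: ind)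
  also have "\<dots> = emeasure haar Y" by (subst nn_integral_haar[symmetric]) auto
  finally have "emeasure lborel A > 0" using pos by simp
  moreover have "minorized_on \<nu> A"
    unfolding minorized_on_def
  proof (intro exI conjI ballI)
    fix f :: "complex \<Rightarrow> ennreal" assume f [measurable]: "f \<in> borel_measurable circle_borel"
    let ?D = "scale_measure (ennreal c) (density haar (indicator Y))"
    have "?D \<le> \<nu>"
    proof (subst le_measure)
      show "sets ?D = sets \<nu>" by (simp add: circle_probD[OF \<nu>])
      show "\<forall>X\<in>sets ?D. emeasure ?D X \<le> emeasure \<nu> X"
      proof
        fix X assume "X \<in> sets ?D"
        then have X [measurable]: "X \<in> sets circle_borel" by simp
        have "emeasure ?D X = ennreal c * emeasure haar (Y \<inter> X)"
          by (simp add: emeasure_density indicator_inter_arith[symmetric])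
        also have "\<dots> \<le> emeasure \<nu> (Y \<inter> X)" by (rule le) auto
        also have "\<dots> \<le> emeasure \<nu> X" by (rule emeasure_mono) (auto simp: circle_probD[OF \<nu>])
        finally show "emeasure ?D X \<le> emeasure \<nu> X" .
      qed
    qed
    then have "(\<integral>\<^sup>+x. f x \<partial>?D) \<le> (\<integral>\<^sup>+x. f x \<partial>\<nu>)"
      by (intro nn_integral_mono_measure) (auto simp: circle_probD[OF \<nu>])
    moreover have "(\<integral>\<^sup>+x. f x \<partial>?D) = ennreal c * (\<integral>\<^sup>+x. indicator Y x * f x \<partial>haar)"
      by (subst nn_integral_scale_measure) (auto simp: nn_integral_density)
    moreover have "(\<integral>\<^sup>+x. indicator Y x * f x \<partial>haar) = (\<integral>\<^sup>+t. f (circle_map t) * indicator A t \<partial>lborel)"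
      by (subst nn_integral_haar) (auto intro!: nn_integral_cong simp: ind[symmetric] mult_ac)
    ultimately show "ennreal c * (\<integral>\<^sup>+t. f (circle_map t) * indicator A t \<partial>lborel) \<le> (\<integral>\<^sup>+x. f x \<partial>\<nu>)" by simp
  qed fact
  moreover have "A \<subseteq> {0..<1}" by (auto simp: A_def)
  ultimately show thesis using that A by blast
qed

text \<open>
  A weak form of the Lebesgue density theorem. Cover \<open>A\<close> by nonoverlapping intervals of total
  length at most \<open>9/8\<close> of its measure. If \<open>A\<close> filled less than \<open>7/8\<close> of each, its measure would be at
  most \<open>63/64\<close> of itself.
\<close>

lemma exists_interval_mostly_filled:
  fixes A :: "real set"
  assumes A: "A \<in> sets borel" "A \<subseteq> {0..<1}" and pos: "emeasure lborel A > 0"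
  obtains a b where "a < b" "measure lborel (A \<inter> {a..b}) \<ge> 7/8 * (b - a)"
proof -
  have fin: "emeasure lborel A < \<infinity>"
  proof -
    have "emeasure lborel A \<le> emeasure lborel {0..1::real}" using A by (intro emeasure_mono) auto
    then show ?thesis by (auto simp: less_top[symmetric] top_unique)
  qed
  have mA: "measure lborel A > 0" using pos fin by (simp add: measure_def enn2real_positive_iff)
  have Al: "A \<in> lmeasurable" using A fin by (auto simp: fmeasurable_def)
  have Acb: "A \<subseteq> cbox 0 1" using A by auto
  have "measure lebesgue A / 8 > 0" using mA A by (simp add: measure_completion)
  from measurable_outer_intervals_bounded[OF Al Acb this]
  obtain \<D> where cnt: "countable \<D>"
    and D: "\<And>K. K \<in> \<D> \<Longrightarrow> K \<subseteq> cbox 0 1 \<and> K \<noteq> {} \<and> (\<exists>c d. K = cbox c d)"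
    and disj: "pairwise (\<lambda>A B. interior A \<inter> interior B = {}) \<D>"
    and int: "\<And>K. \<lbrakk>K \<in> \<D>; box (0::real) 1 \<noteq> {}\<rbrakk> \<Longrightarrow> interior K \<noteq> {}"
    and cov: "A \<subseteq> \<Union>\<D>" and lm: "\<Union>\<D> \<in> lmeasurable"
    and le: "measure lebesgue (\<Union>\<D>) \<le> measure lebesgue A + measure lebesgue A / 8"
    by metis
  show thesis
  proof (rule ccontr)
    assume "\<not> thesis"
    then have small: "\<And>a b. a < b \<Longrightarrow> measure lborel (A \<inter> {a..b}) < 7/8 * (b - a)"
      using that by force
    have K: "\<exists>a b. a < b \<and> K = {a..b}" if "K \<in> \<D>" for K
      using D[OF that] int[OF that] by (force simp: box_real)
    have I [measurable]: "interior K \<in> sets borel" for K :: "real set" by simp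
    have djI: "disjoint_family_on interior \<D>" and djA: "disjoint_family_on (\<lambda>K. A \<inter> interior K) \<D>"
      using disj by (auto simp: disjoint_family_on_def pairwise_def)
    have ends: "K - interior K \<in> null_sets lborel" if "K \<in> \<D>" for K
    proof -
      obtain a b where "K = {a..b}" using K[OF \<open>K \<in> \<D>\<close>] by blast
      then have "K - interior K \<subseteq> {a, b}" by auto
      then show ?thesis by (meson countable_imp_null_set_lborel countable_subset countable_finite finite.intros)
    qed
    \<comment> \<open>Passing to interiors makes the cover disjoint and loses only countably many end points.\<close>
    let ?A = "\<Union>K\<in>\<D>. A \<inter> interior K" and ?R = "\<Union>K\<in>\<D>. K - interior K"
    have R: "?R \<in> null_sets lborel" by (rule null_sets_UN'[OF cnt ends])
    have A': "?A \<in> sets borel" using A cnt by (intro sets.countable_UN') auto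
    have "emeasure lborel A \<le> emeasure lborel (?A \<union> ?R)"
      using cov A' R by (intro emeasure_mono) auto
    also have "\<dots> = emeasure lborel ?A" using A' R by (intro emeasure_Un_null_set) auto
    also have "\<dots> = (\<integral>\<^sup>+K. emeasure lborel (A \<inter> interior K) \<partial>count_space \<D>)"
      using A cnt djA by (intro emeasure_UN_countable) auto
    also have "\<dots> \<le> (\<integral>\<^sup>+K. ennreal (7/8) * emeasure lborel (interior K) \<partial>count_space \<D>)"
    proof (rule nn_integral_mono)
      fix K assume "K \<in> space (count_space \<D>)"
      then obtain a b where ab: "a < b" "K = {a..b}" using K by force
      have "emeasure lborel (A \<inter> interior K) \<le> emeasure lborel (A \<inter> {a..b})"
        using A ab by (intro emeasure_mono) auto
      also have "\<dots> = ennreal (measure lborel (A \<inter> {a..b}))"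
      proof (rule emeasure_eq_ennreal_measure)
        have "emeasure lborel (A \<inter> {a..b}) \<le> emeasure lborel A" using A by (intro emeasure_mono) auto
        then show "emeasure lborel (A \<inter> {a..b}) \<noteq> top_class.top" using fin by auto
      qed
      also have "\<dots> \<le> ennreal (7/8 * (b - a))" using small[OF ab(1)] by (intro ennreal_leI) simp
      also have "\<dots> = ennreal (7/8) * emeasure lborel (interior K)"
        using ab by (simp add: ennreal_mult[symmetric] del: ennreal_divide_numeral)
      finally show "emeasure lborel (A \<inter> interior K) \<le> ennreal (7/8) * emeasure lborel (interior K)" .
    qed
    also have "\<dots> = ennreal (7/8) * (\<integral>\<^sup>+K. emeasure lborel (interior K) \<partial>count_space \<D>)"
      by (rule nn_integral_cmult) auto
    also have "(\<integral>\<^sup>+K. emeasure lborel (interior K) \<partial>count_space \<D>) = emeasure lborel (\<Union>K\<in>\<D>. interior K)"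
      using cnt djI by (intro emeasure_UN_countable[symmetric]) auto
    also have "\<dots> = emeasure lebesgue (\<Union>K\<in>\<D>. interior K)"
    proof -
      have "(\<Union>K\<in>\<D>. interior K) \<in> sets lborel" by (simp add: borel_open open_UN)
      then show ?thesis by (simp add: emeasure_completion[OF sets_completionI_sets])
    qed
    also have "\<dots> \<le> emeasure lebesgue (\<Union>\<D>)"
      using lm interior_subset by (intro emeasure_mono) (auto simp: fmeasurable_def)
    also have "\<dots> = ennreal (measure lebesgue (\<Union>\<D>))"
      using lm by (simp add: emeasure_eq_measure2)
    also have "\<dots> \<le> ennreal (9/8 * measure lborel A)"
      using le A by (intro ennreal_leI) (simp add: measure_completion)
    finally have "emeasure lborel A \<le> ennreal (7/8 * (9/8 * measure lborel A))"
      by (simp add: ennreal_mult[symmetric] mult_left_mono del: ennreal_divide_numeral)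
    moreover have "emeasure lborel A = ennreal (measure lborel A)"
      using fin by (intro emeasure_eq_ennreal_measure) auto
    ultimately show False using mA by (simp add: ennreal_le_iff)
  qed
qed

section \<open>Spreading an arc over the circle\<close>

text \<open>
  With \<open>l = b - a\<close>, the set and its reflection each have measure at least \<open>7/8 * l\<close>, and both lie
  in an interval of length \<open>l + \<bar>u - (a + b)\<bar> \<le> 13/8 * l\<close>, so they overlap in measure at least
  \<open>(14/8 - 13/8) * l\<close>.
\<close>

lemma measure_Int_reflect:
  fixes A :: "real set"
  assumes A: "A \<in> sets borel" "A \<subseteq> {a..b}" and ab: "a \<le> b"
    and big: "measure lborel A \<ge> 7/8 * (b - a)" and u: "\<bar>u - (a + b)\<bar> \<le> 5/8 * (b - a)"
  shows "measure lborel (A \<inter> {s. u - s \<in> A}) \<ge> (b - a) / 8"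
proof -
  let ?B = "{s. u - s \<in> A}"
  have B: "?B \<in> sets borel" using A(1) by measurable
  have fm: "S \<in> fmeasurable lborel" if "S \<in> sets borel" "S \<subseteq> {c..d}" for S :: "real set" and c d
  proof -
    have "emeasure lborel S \<le> emeasure lborel {c..d}" using that by (intro emeasure_mono) auto
    also have "\<dots> < \<infinity>" by (simp add: emeasure_lborel_Icc_eq)
    finally show ?thesis using that by (auto simp: fmeasurable_def)
  qed
  have Bsub: "?B \<subseteq> {u - b..u - a}" using A(2) by auto
  have fA: "A \<in> fmeasurable lborel" and fB: "?B \<in> fmeasurable lborel"
    using fm A B Bsub by blast+
  have "emeasure lborel ?B = (\<integral>\<^sup>+s. indicator A (u + (-1) * s) \<partial>lborel)"
  proof -
    have "(\<integral>\<^sup>+s. indicator A (u + (-1) * s) \<partial>lborel) = (\<integral>\<^sup>+s. indicator ?B s \<partial>lborel)"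
      by (intro nn_integral_cong) (simp add: indicator_def)
    then show ?thesis using B by simp
  qed
  also have "\<dots> = emeasure lborel A"
    using A nn_integral_real_affine[of "indicator A" "-1" u] by simp
  finally have mB: "measure lborel ?B = measure lborel A" by (simp add: measure_def)
  have "measure lborel (A \<union> ?B) = measure lborel A + measure lborel ?B - measure lborel (A \<inter> ?B)"
    using measure_Un3[OF fA fB] by simp
  moreover have "measure lborel (A \<union> ?B) \<le> (b - a) + \<bar>u - (a + b)\<bar>"
  proof -
    let ?J = "{min a (u - b)..max b (u - a)}"
    have "measure lborel (A \<union> ?B) \<le> measure lborel ?J"
      using A B Bsub by (intro measure_mono_fmeasurable fm[where c="min a (u - b)" and d="max b (u - a)"]) fastforce+
    also have "\<dots> = (b - a) + \<bar>u - (a + b)\<bar>"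
      using ab by (auto simp: min_def max_def)
    finally show ?thesis .
  qed
  ultimately have "measure lborel (A \<inter> ?B) \<ge> 2 * measure lborel A - ((b - a) + \<bar>u - (a + b)\<bar>)"
    using mB by simp
  also have "2 * measure lborel A - ((b - a) + \<bar>u - (a + b)\<bar>) \<ge> 2 * (7/8 * (b - a)) - ((b - a) + 5/8 * (b - a))"
    by (intro diff_mono mult_left_mono add_left_mono big u) simp
  also have "2 * (7/8 * (b - a)) - ((b - a) + 5/8 * (b - a)) = (b - a) / 8" by (simp add: field_simps)
  finally show ?thesis .
qed

text \<open>
  The density at \<open>u\<close> of the convolution of Lebesgue measure on \<open>A\<close> with itself is the measure of
  \<open>A \<inter> (u - A)\<close>, which \<open>measure_Int_reflect\<close> bounds below on an interval of length \<open>5/4 * (b - a)\<close>.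
  The hypothesis admits both the initial set of positive measure and, later, the full interval,
  so the same step starts and continues the iteration.
\<close>

lemma minorized_on_double:
  assumes \<mu>: "circle_prob \<mu>" and A [measurable]: "A \<in> sets borel" and Aab: "A \<subseteq> {a..b}" and ab: "a < b"
    and big: "measure lborel A \<ge> 7/8 * (b - a)" and min: "minorized_on (conv_power \<mu> k) A"
  shows "minorized_on (conv_power \<mu> (k + k)) {a + b - 5/8 * (b - a)..a + b + 5/8 * (b - a)}"
proof -
  let ?\<nu> = "conv_power \<mu> k" and ?J = "{a + b - 5/8 * (b - a)..a + b + 5/8 * (b - a)}"
  note P = circle_prob_conv_power[OF \<mu>]
  obtain c where c0: "c > 0" and c: "\<And>f. f \<in> borel_measurable circle_borel \<Longrightarrow>
     ennreal c * (\<integral>\<^sup>+t. f (circle_map t) * indicator A t \<partial>lborel) \<le> (\<integral>\<^sup>+x. f x \<partial>?\<nu>)"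
    using min by (auto simp: minorized_on_def)
  let ?d = "(b - a) / 8"
  show ?thesis
    unfolding minorized_on_def
  proof (intro exI conjI ballI)
    show "c * c * ?d > 0" using c0 ab by simp
    fix f :: "complex \<Rightarrow> ennreal" assume f [measurable]: "f \<in> borel_measurable circle_borel"
    define F where "F t = f (circle_map t)" for t
    have F [measurable]: "F \<in> borel_measurable borel" unfolding F_def by measurable
    have ov: "ennreal ?d \<le> (\<integral>\<^sup>+s. indicator A s * indicator A (u - s) \<partial>lborel)" if "u \<in> ?J" for u
    proof -
      let ?B = "{s. u - s \<in> A}"
      have B: "?B \<in> sets borel" by measurable
      have "emeasure lborel (A \<inter> ?B) \<le> emeasure lborel {a..b}" using Aab by (intro emeasure_mono) auto
      then have "emeasure lborel (A \<inter> ?B) \<noteq> top_class.top" using ab by (auto simp: top_unique)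
      then have "emeasure lborel (A \<inter> ?B) = ennreal (measure lborel (A \<inter> ?B))" by (rule emeasure_eq_ennreal_measure)
      moreover have "measure lborel (A \<inter> ?B) \<ge> ?d"
      proof (rule measure_Int_reflect[OF A Aab _ big])
        have "u - (a + b) \<le> 5/8 * (b - a)" "- (u - (a + b)) \<le> 5/8 * (b - a)"
          using \<open>u \<in> ?J\<close> unfolding atLeastAtMost_iff by linarith+
        then show "\<bar>u - (a + b)\<bar> \<le> 5/8 * (b - a)" by (rule abs_leI)
      qed (use ab in simp)
      ultimately have "ennreal ?d \<le> emeasure lborel (A \<inter> ?B)" by (simp add: ennreal_leI)
      also have "\<dots> = (\<integral>\<^sup>+s. indicator (A \<inter> ?B) s \<partial>lborel)" using B by simp
      also have "\<dots> = (\<integral>\<^sup>+s. indicator A s * indicator A (u - s) \<partial>lborel)"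
        by (intro nn_integral_cong) (auto split: split_indicator)
      finally show ?thesis .
    qed
    have "ennreal ?d * (\<integral>\<^sup>+u. F u * indicator ?J u \<partial>lborel)
        = (\<integral>\<^sup>+u. F u * (ennreal ?d * indicator ?J u) \<partial>lborel)"
      by (subst nn_integral_cmult[symmetric]) (auto simp: mult_ac)
    also have "\<dots> \<le> (\<integral>\<^sup>+u. F u * (\<integral>\<^sup>+s. indicator A s * indicator A (u - s) \<partial>lborel) \<partial>lborel)"
      using ov by (intro nn_integral_mono mult_left_mono) (auto split: split_indicator)
    also have "\<dots> = (\<integral>\<^sup>+u. \<integral>\<^sup>+s. F u * (indicator A s * indicator A (u - s)) \<partial>lborel \<partial>lborel)"
      by (intro nn_integral_cong nn_integral_cmult[symmetric]) measurable
    also have "\<dots> = (\<integral>\<^sup>+s. \<integral>\<^sup>+u. F u * (indicator A s * indicator A (u - s)) \<partial>lborel \<partial>lborel)"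
      by (rule lborel_pair.Fubini') measurable
    also have "\<dots> = (\<integral>\<^sup>+s. (\<integral>\<^sup>+t. F (s + t) * indicator A t \<partial>lborel) * indicator A s \<partial>lborel)"
    proof (rule nn_integral_cong)
      fix s
      have "(\<integral>\<^sup>+u. F u * (indicator A s * indicator A (u - s)) \<partial>lborel)
          = (\<integral>\<^sup>+t. F (s + t) * (indicator A s * indicator A (s + t - s)) \<partial>lborel)"
        by (rule nn_integral_lborel_shift[symmetric]) measurable
      also have "\<dots> = (\<integral>\<^sup>+t. F (s + t) * indicator A t \<partial>lborel) * indicator A s"
        by (subst nn_integral_multc[symmetric]) (auto simp: mult_ac)
      finally show "(\<integral>\<^sup>+u. F u * (indicator A s * indicator A (u - s)) \<partial>lborel)
          = (\<integral>\<^sup>+t. F (s + t) * indicator A t \<partial>lborel) * indicator A s" .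
    qed
    finally have 1: "ennreal ?d * (\<integral>\<^sup>+u. F u * indicator ?J u \<partial>lborel)
       \<le> (\<integral>\<^sup>+s. (\<integral>\<^sup>+t. F (s + t) * indicator A t \<partial>lborel) * indicator A s \<partial>lborel)" .
    have "ennreal c * (ennreal c * (\<integral>\<^sup>+s. (\<integral>\<^sup>+t. F (s + t) * indicator A t \<partial>lborel) * indicator A s \<partial>lborel))
       = ennreal c * (\<integral>\<^sup>+s. ennreal c * (\<integral>\<^sup>+t. F (s + t) * indicator A t \<partial>lborel) * indicator A s \<partial>lborel)"
      by (subst nn_integral_cmult[symmetric]) (auto simp: mult_ac)
    also have "\<dots> \<le> ennreal c * (\<integral>\<^sup>+s. (\<integral>\<^sup>+y. f (circle_map s * y) \<partial>?\<nu>) * indicator A s \<partial>lborel)"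
    proof (intro mult_left_mono nn_integral_mono mult_right_mono)
      fix s
      have "(\<lambda>y. f (circle_map s * y)) \<in> borel_measurable circle_borel"
        by (rule measurable_compose[OF measurable_circle_mult_left[OF circle_map_in_sphere] f])
      from c[OF this] show "ennreal c * (\<integral>\<^sup>+t. F (s + t) * indicator A t \<partial>lborel) \<le> (\<integral>\<^sup>+y. f (circle_map s * y) \<partial>?\<nu>)"
        by (simp add: F_def circle_map_add)
    qed auto
    also have "\<dots> \<le> (\<integral>\<^sup>+x. \<integral>\<^sup>+y. f (x * y) \<partial>?\<nu> \<partial>?\<nu>)"
      by (rule c[OF borel_measurable_nn_integral_translate[OF P f]])
    also have "\<dots> = (\<integral>\<^sup>+x. f x \<partial>conv_power \<mu> (k + k))"
      by (rule nn_integral_conv_power_add[OF \<mu> f, symmetric])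
    finally have 2: "ennreal c * (ennreal c * (\<integral>\<^sup>+s. (\<integral>\<^sup>+t. F (s + t) * indicator A t \<partial>lborel) * indicator A s \<partial>lborel))
      \<le> (\<integral>\<^sup>+x. f x \<partial>conv_power \<mu> (k + k))" .
    have "ennreal (c * c * ?d) * (\<integral>\<^sup>+t. f (circle_map t) * indicator ?J t \<partial>lborel)
       = ennreal c * (ennreal c * (ennreal ?d * (\<integral>\<^sup>+u. F u * indicator ?J u \<partial>lborel)))"
      using c0 ab by (simp add: ennreal_mult F_def mult.assoc del: times_divide_eq_right)
    also have "\<dots> \<le> (\<integral>\<^sup>+x. f x \<partial>conv_power \<mu> (k + k))"
      using 1 by (intro order_trans[OF _ 2] mult_left_mono) auto
    finally show "ennreal (c * c * ?d) * (\<integral>\<^sup>+t. f (circle_map t) * indicator ?J t \<partial>lborel)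
       \<le> (\<integral>\<^sup>+x. f x \<partial>conv_power \<mu> (k + k))" .
  qed
qed

lemma minorized_on_long_interval:
  assumes \<mu>: "circle_prob \<mu>" and ab: "a < b" and min: "minorized_on (conv_power \<mu> k) {a..b}" and k: "k \<ge> 1"
  shows "\<exists>j\<ge>1. \<exists>a' b'. b' - a' = (5/4)^n * (b - a) \<and> minorized_on (conv_power \<mu> j) {a'..b'}"
proof (induction n)
  case 0 then show ?case using min k by auto
next
  case (Suc n)
  then obtain j a' b' where j: "j \<ge> 1" and l: "b' - a' = (5/4)^n * (b - a)"
    and m: "minorized_on (conv_power \<mu> j) {a'..b'}" by blast
  have "b' - a' > 0" using l ab by simp
  then have "minorized_on (conv_power \<mu> (j + j)) {a' + b' - 5/8 * (b' - a')..a' + b' + 5/8 * (b' - a')}"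
    by (intro minorized_on_double[OF \<mu> _ subset_refl _ _ m]) auto
  moreover have "a' + b' + 5/8 * (b' - a') - (a' + b' - 5/8 * (b' - a')) = (5/4)^Suc n * (b - a)"
    using l by simp
  moreover have "j + j \<ge> 1" using j by simp
  ultimately show ?case by blast
qed

text \<open>
  Once the interval has length at least \<open>1\<close>, it contains a full period, and Lebesgue measure on a period is
  mapped to Haar measure.
\<close>

theorem nonsingular_power_imp_ge_haar:
  assumes \<mu>: "circle_prob \<mu>" and k: "k \<ge> 1" and ns: "nonsingular (conv_power \<mu> k)"
  obtains n c where "n \<ge> 1" "c > 0"
    "\<And>A. A \<in> sets circle_borel \<Longrightarrow> c * measure haar A \<le> measure (conv_power \<mu> n) A"
proof -
  note P = circle_prob_conv_power[OF \<mu>]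
  from nonsingular_imp_minorized_on[OF P ns] obtain A where A: "A \<in> sets borel" "A \<subseteq> {0..<1}"
    "emeasure lborel A > 0" and mA: "minorized_on (conv_power \<mu> k) A" by blast
  from exists_interval_mostly_filled[OF A] obtain a b where ab: "a < b"
    and big: "7/8 * (b - a) \<le> measure lborel (A \<inter> {a..b})" by blast
  let ?a = "a + b - 5/8 * (b - a)" and ?b = "a + b + 5/8 * (b - a)"
  have "minorized_on (conv_power \<mu> (k + k)) {?a..?b}"
    using A(1) by (intro minorized_on_double[OF \<mu> _ _ ab big minorized_on_subset[OF mA]]) auto
  moreover have "?a < ?b" using ab by (simp add: field_simps)
  moreover obtain n where n: "(5/4)^n * (?b - ?a) \<ge> 1"
  proof -
    obtain n where "(1 / (?b - ?a)) < (5/4::real)^n" using real_arch_pow[of "5/4"] by auto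
    then show ?thesis using ab by (intro that[of n]) (simp add: field_simps)
  qed
  ultimately obtain j a' b' where j: "j \<ge> 1" and l: "b' - a' = (5/4)^n * (?b - ?a)"
    and m: "minorized_on (conv_power \<mu> j) {a'..b'}"
    using minorized_on_long_interval[OF \<mu>, of ?a ?b "k + k" n] k by auto
  have "{a'..<a' + 1} \<subseteq> {a'..b'}" using l n by auto
  from minorized_on_subset[OF m this] obtain c where c0: "c > 0"
    and c: "\<And>f. f \<in> borel_measurable circle_borel \<Longrightarrow>
     ennreal c * (\<integral>\<^sup>+t. f (circle_map t) * indicator {a'..<a' + 1} t \<partial>lborel) \<le> (\<integral>\<^sup>+x. f x \<partial>conv_power \<mu> j)"
    by (auto simp: minorized_on_def)
  have "c * measure haar B \<le> measure (conv_power \<mu> j) B" if B [measurable]: "B \<in> sets circle_borel" for B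
  proof -
    interpret H: prob_space haar by (rule prob_space_haar)
    interpret C: prob_space "conv_power \<mu> j" by (rule circle_probD[OF P])
    have "ennreal c * emeasure haar B = ennreal c * (\<integral>\<^sup>+t. indicator B (circle_map t) * indicator {a'..<a' + 1} t \<partial>lborel)"
      by (subst nn_integral_periodic) (auto simp: nn_integral_haar[symmetric] circle_map_add)
    also have "\<dots> \<le> emeasure (conv_power \<mu> j) B"
      using c[of "indicator B"] circle_probD(2)[OF P] by simp
    finally show ?thesis using c0
      by (simp add: H.emeasure_eq_measure C.emeasure_eq_measure ennreal_mult[symmetric])
  qed
  with that[OF j c0] show thesis by blast
qed

section \<open>Doeblin's condition\<close>

lemma nonsingular_power_if_doeblin:
  assumes \<mu>: "circle_prob \<mu>" and "doeblin (markov_op \<mu>)"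
  shows "\<exists>k\<ge>1. nonsingular (conv_power \<mu> k)"
proof -
  note P = circle_prob_conv_power[OF \<mu>]
  obtain n \<epsilon> where n: "n \<ge> 1" and \<epsilon>: "0 < \<epsilon>" "\<epsilon> < 1" and
    D: "\<And>A. A \<in> sets circle_borel \<Longrightarrow> measure haar A < 1 - \<epsilon> \<Longrightarrow>
      (SUP x\<in>sphere 0 1. transition_prob (markov_op \<mu>) n x A) \<le> \<epsilon>"
    using assms(2) unfolding doeblin_def by blast
  interpret C: prob_space "conv_power \<mu> n" by (rule circle_probD[OF P])
  have "\<not> singular (conv_power \<mu> n)"
  proof
    assume "singular (conv_power \<mu> n)"
    then obtain N where N: "N \<in> sets circle_borel" "emeasure haar N = 0"
      "emeasure (conv_power \<mu> n) (sphere 0 1 - N) = 0" by (auto simp: singular_def)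
    have one: "(1::complex) \<in> sphere 0 1" by simp
    have le1: "transition_prob (markov_op \<mu>) n x N \<le> 1" if "x \<in> sphere 0 1" for x
      by (simp only: transition_prob_markov_op[OF \<mu> N(1) that] C.prob_le_1)
    have "transition_prob (markov_op \<mu>) n 1 N \<le> (SUP x\<in>sphere 0 1. transition_prob (markov_op \<mu>) n x N)"
      using le1 by (intro cSUP_upper bdd_aboveI2) auto
    also have "\<dots> \<le> \<epsilon>" using D[OF N(1)] N(2) \<epsilon> by (simp add: measure_def)
    finally have "transition_prob (markov_op \<mu>) n 1 N \<le> \<epsilon>" .
    moreover have "{y \<in> sphere 0 1. 1 * y \<in> N} = N"
      using sets_circle_borelD[OF N(1)] by auto
    ultimately have "measure (conv_power \<mu> n) N \<le> \<epsilon>"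
      using transition_prob_markov_op[OF \<mu> N(1) one, of n] by simp
    moreover have "measure (conv_power \<mu> n) N = 1"
      using C.prob_compl[of N] N by (simp add: circle_probD[OF P] measure_def)
    ultimately show False using \<epsilon> by simp
  qed
  with n show ?thesis by (auto simp: nonsingular_def)
qed

lemma doeblin_if_ge_haar:
  assumes \<mu>: "circle_prob \<mu>" and n: "n \<ge> 1" and c: "c > 0"
    and le: "\<And>A. A \<in> sets circle_borel \<Longrightarrow> c * measure haar A \<le> measure (conv_power \<mu> n) A"
  shows "doeblin (markov_op \<mu>)"
  unfolding doeblin_def
proof (intro exI conjI ballI impI)
  note P = circle_prob_conv_power[OF \<mu>]
  interpret H: prob_space haar by (rule prob_space_haar)
  interpret C: prob_space "conv_power \<mu> n" by (rule circle_probD[OF P])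
  show "n \<ge> 1" by fact
  show "0 < 1 / (1 + c)" "1 / (1 + c) < 1" using c by auto
  fix A assume A: "A \<in> sets circle_borel" and small: "measure haar A < 1 - 1 / (1 + c)"
  show "(SUP x\<in>sphere 0 1. transition_prob (markov_op \<mu>) n x A) \<le> 1 / (1 + c)"
  proof (rule cSUP_least)
    have "(1::complex) \<in> sphere 0 1" by simp
    then show "sphere 0 1 \<noteq> ({} :: complex set)" by blast
    fix x :: complex assume x: "x \<in> sphere 0 1"
    let ?S = "{y \<in> sphere 0 1. x * y \<in> A}"
    have S: "?S \<in> sets circle_borel" by (rule vimage_translate_in_sets[OF A x])
    have "c * (1 / (1 + c)) \<le> c * (1 - measure haar ?S)"
      using small c measure_haar_translate[OF A x] by (intro mult_left_mono) auto
    also have "\<dots> = c * measure haar (space circle_borel - ?S)"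
      using H.prob_compl[of ?S] S by simp
    also have "\<dots> \<le> measure (conv_power \<mu> n) (space circle_borel - ?S)"
      by (rule le) (rule sets.compl_sets[OF S])
    also have "\<dots> = 1 - measure (conv_power \<mu> n) ?S"
      using C.prob_compl[of ?S] S by (simp add: circle_probD[OF P])
    finally have "measure (conv_power \<mu> n) ?S \<le> 1 - c * (1 / (1 + c))" by simp
    \<comment> \<open>The threshold \<open>1 / (1 + c)\<close> is the fixed point of \<open>\<epsilon> \<mapsto> 1 - c * \<epsilon>\<close>.\<close>
    also have "\<dots> = 1 / (1 + c)" using c by (simp add: field_simps)
    finally show "transition_prob (markov_op \<mu>) n x A \<le> 1 / (1 + c)"
      by (simp add: transition_prob_markov_op[OF \<mu> A x])
  qed
qed

lemma doeblin_iff_nonsingular_power: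
  assumes \<mu>: "circle_prob \<mu>"
  shows "doeblin (markov_op \<mu>) \<longleftrightarrow> (\<exists>k\<ge>1. nonsingular (conv_power \<mu> k))"
  using nonsingular_power_if_doeblin[OF \<mu>] nonsingular_power_imp_ge_haar[OF \<mu>]
    doeblin_if_ge_haar[OF \<mu>] by metis

lemma doeblin_dual_markov_op_iff:
  assumes \<mu>: "circle_prob \<mu>"
  shows "doeblin (markov_op \<mu>) \<longleftrightarrow> doeblin (dual_markov_op \<mu>)"
  unfolding dual_markov_op_def doeblin_iff_nonsingular_power[OF \<mu>]
    doeblin_iff_nonsingular_power[OF circle_prob_reflected[OF \<mu>]]
  by (simp add: nonsingular_def singular_conv_power_reflected_iff[OF \<mu>])

section \<open>Equality of the operator norms\<close>

lemma Lp_norm_1: "Lp_norm 1 f = (\<integral>\<^sup>+x. ennreal (norm (f x)) \<partial>haar)"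
  by (simp add: Lp_norm_def Let_def ennreal_enn2real_if)

lemma Lp_norm_infinity: "Lp_norm \<infinity> f = esssup haar (\<lambda>x. ennreal (norm (f x)))"
  by (simp add: Lp_norm_def)

lemma nn_integral_haar_inverse:
  assumes [measurable]: "f \<in> borel_measurable circle_borel"
  shows "(\<integral>\<^sup>+x. f (inverse x) \<partial>haar) = (\<integral>\<^sup>+x. f x \<partial>haar)"
proof -
  have "(\<integral>\<^sup>+x. f x \<partial>distr haar circle_borel inverse) = (\<integral>\<^sup>+x. f (inverse x) \<partial>haar)"
    by (rule nn_integral_distr) auto
  then show ?thesis by (simp add: distr_haar_inverse)
qed

text \<open>
  Symmetry for the pairing of \<open>f\<close> with \<open>x \<mapsto> g (inverse x)\<close>. The inversion turns the
  adjoint of a convolution operator back into the operator itself, so the dual of \<open>T\<close> on \<open>L\<^sub>1\<close> can be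
  expressed by \<open>T\<close> on bounded functions.
\<close>

locale reflection_symmetric =
  fixes T :: "(complex \<Rightarrow> complex) \<Rightarrow> complex \<Rightarrow> complex"
  assumes measurable_T: "f \<in> borel_measurable circle_borel \<Longrightarrow> T f \<in> borel_measurable circle_borel"
    and integrable_T: "integrable haar f \<Longrightarrow> integrable haar (T f)"
    and symmetric_T: "integrable haar f \<Longrightarrow> g \<in> borel_measurable circle_borel \<Longrightarrow> (\<And>x. norm (g x) \<le> B) \<Longrightarrow>
      (\<integral>x. T f x * g (inverse x) \<partial>haar) = (\<integral>x. f x * T g (inverse x) \<partial>haar)"
begin

text \<open>
  The test function that turns the pairing with \<open>T f\<close> into the integral of \<open>w * \<bar>T f\<bar>\<close>. The norm on
  \<open>L\<^sub>1\<close> takes the weight \<open>w = 1\<close>, the norm on \<open>L\<^sub>\<infinity>\<close> a normalized indicator of a set where \<open>T f\<close> is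
  large.
\<close>

definition dual_test :: "(complex \<Rightarrow> real) \<Rightarrow> (complex \<Rightarrow> complex) \<Rightarrow> complex \<Rightarrow> complex" where
  "dual_test w f x = of_real (w (inverse x)) * cnj (sgn (T f (inverse x)))"

lemma measurable_dual_test:
  assumes [measurable]: "f \<in> borel_measurable circle_borel" "w \<in> borel_measurable circle_borel"
  shows "dual_test w f \<in> borel_measurable circle_borel"
proof -
  have [measurable]: "T f \<in> borel_measurable circle_borel" by (rule measurable_T) fact
  have [measurable]: "cnj \<in> borel_measurable borel" "sgn \<in> borel_measurable (borel :: complex measure)"
    by (intro borel_measurable_continuous_onI continuous_intros)
       (simp add: sgn_div_norm scaleR_conv_of_real[abs_def])
  show ?thesis unfolding dual_test_def by measurable
qed

lemma norm_dual_test: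
  assumes "\<And>x. 0 \<le> w x" shows "norm (dual_test w f x) \<le> w (inverse x)"
  using assms[of "inverse x"] by (simp add: dual_test_def norm_mult norm_sgn)

text \<open>
  The left side is the pairing of \<open>T f\<close> with the test function; symmetry moves \<open>T\<close> onto the test
  function, and the modulus is then taken under the integral.
\<close>

lemma weighted_norm_le_dual:
  assumes f: "integrable haar f" and w [measurable]: "w \<in> borel_measurable circle_borel"
    and wB: "\<And>x. 0 \<le> w x" "\<And>x. w x \<le> B"
  shows "(\<integral>\<^sup>+x. ennreal (w x * norm (T f x)) \<partial>haar)
    \<le> (\<integral>\<^sup>+x. ennreal (norm (f x)) * ennreal (norm (T (dual_test w f) (inverse x))) \<partial>haar)"
proof -
  let ?g = "dual_test w f"
  have f' [measurable]: "f \<in> borel_measurable circle_borel"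
    using f by (auto dest: borel_measurable_integrable)
  note Tf = integrable_T[OF f]
  have [measurable]: "T f \<in> borel_measurable circle_borel" by (rule measurable_T) fact
  have int: "integrable haar (\<lambda>x. w x * norm (T f x))"
  proof (rule Bochner_Integration.integrable_bound[OF integrable_mult_right[OF integrable_norm[OF Tf], of B]])
    show "AE x in haar. norm (w x * norm (T f x)) \<le> norm (B * norm (T f x))"
      using wB by (intro AE_I2) (auto simp: abs_mult intro!: mult_right_mono order_trans[OF _ abs_ge_self])
  qed measurable
  have eq: "T f x * ?g (inverse x) = of_real (w x * norm (T f x))" for x
  proof -
    have "z * cnj (sgn z) = of_real (norm z)" for z :: complex
      using complex_norm_square[of z]
      by (cases "z = 0") (simp_all add: sgn_div_norm scaleR_conv_of_real field_simps power2_eq_square)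
    from this[of "T f x"] show ?thesis by (simp add: dual_test_def mult_ac)
  qed
  have "(\<integral>\<^sup>+x. ennreal (w x * norm (T f x)) \<partial>haar) = ennreal (\<integral>x. w x * norm (T f x) \<partial>haar)"
    using wB by (intro nn_integral_eq_integral int AE_I2) auto
  also have "\<dots> = ennreal (norm (\<integral>x. complex_of_real (w x * norm (T f x)) \<partial>haar))"
    using wB by (subst integral_complex_of_real) (simp add: integral_nonneg_AE)
  also have "\<dots> = ennreal (norm (\<integral>x. f x * T ?g (inverse x) \<partial>haar))"
    using symmetric_T[OF f measurable_dual_test[OF f' w] order_trans[OF norm_dual_test wB(2)]] wB(1)
    by (simp add: eq)
  also have "\<dots> \<le> (\<integral>\<^sup>+x. ennreal (norm (f x * T ?g (inverse x))) \<partial>haar)"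
    by (cases "integrable haar (\<lambda>x. f x * T ?g (inverse x))")
       (auto intro: integral_norm_bound_ennreal simp: not_integrable_integral_eq)
  also have "\<dots> = (\<integral>\<^sup>+x. ennreal (norm (f x)) * ennreal (norm (T ?g (inverse x))) \<partial>haar)"
    by (simp add: norm_mult ennreal_mult)
  finally show ?thesis .
qed

lemma integrable_haar_if_Lp_norm_1:
  assumes "f \<in> borel_measurable circle_borel" "Lp_norm 1 f \<le> 1"
  shows "integrable haar f"
  using assms by (intro integrableI_bounded) (auto simp: Lp_norm_1 order.strict_trans1)

lemma Lp_norm_le_op_norm:
  assumes "g \<in> borel_measurable circle_borel" "Lp_norm p g \<le> 1"
  shows "Lp_norm p (T g) \<le> Lp_op_norm p T"
  using assms unfolding Lp_op_norm_def by (intro SUP_upper) simp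

lemma op_norm_1_le_infinity: "Lp_op_norm 1 T \<le> Lp_op_norm \<infinity> T"
  unfolding Lp_op_norm_def[of 1]
proof (rule SUP_least, safe)
  fix f assume "f \<in> borel_measurable haar" and f1: "Lp_norm 1 f \<le> 1"
  then have f [measurable]: "f \<in> borel_measurable circle_borel" by simp
  let ?g = "dual_test (\<lambda>_. 1) f"
  have g: "?g \<in> borel_measurable circle_borel" by (rule measurable_dual_test) auto
  then have [measurable]: "T ?g \<in> borel_measurable circle_borel" by (rule measurable_T)
  have "Lp_norm \<infinity> ?g \<le> 1"
    unfolding Lp_norm_infinity using norm_dual_test[of "\<lambda>_. 1"] g by (intro esssup_I AE_I2) (auto simp: ennreal_le_1)
  then have K: "AE x in haar. ennreal (norm (T ?g x)) \<le> Lp_op_norm \<infinity> T"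
    using Lp_norm_le_op_norm[OF g, of \<infinity>] esssup_AE[of "\<lambda>x. ennreal (norm (T ?g x))" haar]
    unfolding Lp_norm_infinity by (auto elim: eventually_mono intro: order_trans)
  have "Lp_norm 1 (T f) = (\<integral>\<^sup>+x. ennreal (1 * norm (T f x)) \<partial>haar)" by (simp add: Lp_norm_1)
  also have "\<dots> \<le> (\<integral>\<^sup>+x. ennreal (norm (f x)) * ennreal (norm (T ?g (inverse x))) \<partial>haar)"
    by (rule weighted_norm_le_dual[OF integrable_haar_if_Lp_norm_1[OF f f1]]) auto
  also have "\<dots> = (\<integral>\<^sup>+x. ennreal (norm (f (inverse x))) * ennreal (norm (T ?g x)) \<partial>haar)"
    by (subst nn_integral_haar_inverse[symmetric]) auto
  also have "\<dots> \<le> (\<integral>\<^sup>+x. ennreal (norm (f (inverse x))) * Lp_op_norm \<infinity> T \<partial>haar)"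
    using K by (intro nn_integral_mono_AE) (auto elim!: eventually_mono intro!: mult_left_mono)
  also have "\<dots> = (\<integral>\<^sup>+x. ennreal (norm (f (inverse x))) \<partial>haar) * Lp_op_norm \<infinity> T"
    by (rule nn_integral_multc) auto
  also have "\<dots> = Lp_norm 1 f * Lp_op_norm \<infinity> T"
    by (subst nn_integral_haar_inverse) (auto simp: Lp_norm_1)
  also have "\<dots> \<le> 1 * Lp_op_norm \<infinity> T" using f1 by (rule mult_right_mono) simp
  finally show "Lp_norm 1 (T f) \<le> Lp_op_norm \<infinity> T" by simp
qed

text \<open>
  If the essential supremum of \<open>T f\<close> exceeded some \<open>z\<close> above the \<open>L\<^sub>1\<close> norm of \<open>T\<close>, then averaging
  the modulus of \<open>T f\<close> over the set where it is larger than \<open>z\<close> would produce a test function in the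
  unit ball of \<open>L\<^sub>1\<close> that \<open>T\<close> maps to norm at least \<open>z\<close>.
\<close>

lemma op_norm_infinity_le_1: "Lp_op_norm \<infinity> T \<le> Lp_op_norm 1 T"
  unfolding Lp_op_norm_def[of \<infinity>]
proof (rule SUP_least, safe)
  fix f assume "f \<in> borel_measurable haar" and f1: "Lp_norm \<infinity> f \<le> 1"
  then have f [measurable]: "f \<in> borel_measurable circle_borel" by simp
  have [measurable]: "T f \<in> borel_measurable circle_borel" by (rule measurable_T) fact
  interpret H: prob_space haar by (rule prob_space_haar)
  have AE1: "AE x in haar. ennreal (norm (f x)) \<le> 1"
    using esssup_AE[of "\<lambda>x. ennreal (norm (f x))" haar]
    by (rule eventually_mono) (erule order_trans[OF _ f1[unfolded Lp_norm_infinity]])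
  then have int: "integrable haar f"
    by (intro H.integrable_const_bound[of _ 1]) (auto simp: ennreal_le_1)
  show "Lp_norm \<infinity> (T f) \<le> Lp_op_norm 1 T"
  proof (rule ccontr)
    assume "\<not> ?thesis"
    then obtain z where z: "Lp_op_norm 1 T < z" "z < Lp_norm \<infinity> (T f)"
      by (auto simp: not_le dest: dense)
    define A where "A = {x \<in> space haar. ennreal (norm (T f x)) > z}"
    have "A \<in> sets haar" unfolding A_def by measurable
    then have A [measurable]: "A \<in> sets circle_borel" by simp
    have "emeasure haar A > 0"
      unfolding A_def using z(2)[unfolded Lp_norm_infinity] by (intro esssup_pos_measure) auto
    then have mA: "measure haar A > 0" by (simp add: H.emeasure_eq_measure)
    define w where "w x = indicator A x / measure haar A" for x
    have [measurable]: "w \<in> borel_measurable circle_borel" unfolding w_def by measurable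
    have w0: "0 \<le> w x" and wB: "w x \<le> 1 / measure haar A" for x
      using mA by (auto simp: w_def indicator_def)
    have wint: "(\<integral>\<^sup>+x. ennreal (w x) \<partial>haar) = 1"
    proof -
      have "(\<integral>\<^sup>+x. ennreal (w x) \<partial>haar) = (\<integral>\<^sup>+x. ennreal (1 / measure haar A) * indicator A x \<partial>haar)"
        by (intro nn_integral_cong) (auto simp: w_def split: split_indicator)
      also have "\<dots> = 1"
        using mA by (subst nn_integral_cmult_indicator) (auto simp: H.emeasure_eq_measure ennreal_mult[symmetric])
      finally show ?thesis .
    qed
    let ?g = "dual_test w f"
    have g: "?g \<in> borel_measurable circle_borel" by (rule measurable_dual_test) auto
    then have [measurable]: "T ?g \<in> borel_measurable circle_borel" by (rule measurable_T)
    have "Lp_norm 1 ?g \<le> (\<integral>\<^sup>+x. ennreal (w (inverse x)) \<partial>haar)"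
      unfolding Lp_norm_1 by (intro nn_integral_mono ennreal_leI norm_dual_test w0)
    also have "\<dots> = 1" by (subst nn_integral_haar_inverse) (auto simp: wint)
    finally have g1: "Lp_norm 1 ?g \<le> 1" .
    have "z = z * (\<integral>\<^sup>+x. ennreal (w x) \<partial>haar)" by (simp add: wint)
    also have "\<dots> = (\<integral>\<^sup>+x. z * ennreal (w x) \<partial>haar)" by (rule nn_integral_cmult[symmetric]) auto
    also have "\<dots> \<le> (\<integral>\<^sup>+x. ennreal (w x * norm (T f x)) \<partial>haar)"
    proof (rule nn_integral_mono)
      fix x assume "x \<in> space haar"
      show "z * ennreal (w x) \<le> ennreal (w x * norm (T f x))"
      proof (cases "x \<in> A")
        case True
        then have "z * ennreal (w x) \<le> ennreal (norm (T f x)) * ennreal (w x)"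
          by (intro mult_right_mono) (auto simp: A_def)
        then show ?thesis using w0 by (simp add: ennreal_mult mult.commute)
      qed (simp add: w_def)
    qed
    also have "\<dots> \<le> (\<integral>\<^sup>+x. ennreal (norm (f x)) * ennreal (norm (T ?g (inverse x))) \<partial>haar)"
      by (rule weighted_norm_le_dual[OF int _ w0 wB]) auto
    also have "\<dots> \<le> (\<integral>\<^sup>+x. 1 * ennreal (norm (T ?g (inverse x))) \<partial>haar)"
      by (intro nn_integral_mono_AE eventually_mono[OF AE1] mult_right_mono) auto
    also have "\<dots> = Lp_norm 1 (T ?g)"
      using nn_integral_haar_inverse[of "\<lambda>x. ennreal (norm (T ?g x))"] by (simp add: Lp_norm_1)
    also have "\<dots> \<le> Lp_op_norm 1 T" by (rule Lp_norm_le_op_norm[OF g g1])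
    finally show False using z(1) by simp
  qed
qed

lemma op_norm_infinity_eq_1: "Lp_op_norm \<infinity> T = Lp_op_norm 1 T"
  by (rule antisym[OF op_norm_infinity_le_1 op_norm_1_le_infinity])

end

lemma borel_measurable_markov_op:
  fixes f :: "complex \<Rightarrow> complex"
  assumes \<mu>: "circle_prob \<mu>" and f: "f \<in> borel_measurable circle_borel"
  shows "markov_op \<mu> f \<in> borel_measurable circle_borel"
proof -
  interpret M: prob_space \<mu> by (rule circle_probD[OF \<mu>])
  show ?thesis unfolding markov_op_def
    using measurable_circle_joint[OF \<mu> f] by (rule M.borel_measurable_lebesgue_integral)
qed

lemma nn_integral_haar_translate_right:
  assumes "f \<in> borel_measurable circle_borel" "y \<in> sphere 0 1"
  shows "(\<integral>\<^sup>+x. f (x * y) \<partial>haar) = (\<integral>\<^sup>+x. f x \<partial>haar)"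
  using nn_integral_haar_translate[OF assms] by (simp add: mult.commute)

lemma integrable_translate_pair:
  fixes f :: "complex \<Rightarrow> complex"
  assumes \<mu>: "circle_prob \<mu>" and f: "integrable haar f"
  shows "integrable (haar \<Otimes>\<^sub>M \<mu>) (\<lambda>(x, y). f (x * y))"
proof (rule integrableI_bounded)
  interpret M: prob_space \<mu> by (rule circle_probD[OF \<mu>])
  interpret H: prob_space haar by (rule prob_space_haar)
  interpret P: pair_prob_space haar \<mu> ..
  note [measurable_cong] = circle_probD(2)[OF \<mu>]
  have f' [measurable]: "f \<in> borel_measurable circle_borel" using borel_measurable_integrable[OF f] by simp
  show m [measurable]: "(\<lambda>(x, y). f (x * y)) \<in> borel_measurable (haar \<Otimes>\<^sub>M \<mu>)"
    using measurable_circle_joint[OF \<mu> f'] by (simp cong: measurable_cong_sets sets_pair_measure_cong)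
  have "(\<integral>\<^sup>+p. ennreal (norm (case p of (x, y) \<Rightarrow> f (x * y))) \<partial>(haar \<Otimes>\<^sub>M \<mu>))
      = (\<integral>\<^sup>+y. \<integral>\<^sup>+x. ennreal (norm (f (x * y))) \<partial>haar \<partial>\<mu>)"
    by (subst P.nn_integral_snd[symmetric]) auto
  also have "\<dots> = (\<integral>\<^sup>+y. \<integral>\<^sup>+x. ennreal (norm (f x)) \<partial>haar \<partial>\<mu>)"
    by (intro nn_integral_cong nn_integral_haar_translate_right) (auto simp: circle_probD[OF \<mu>])
  also have "\<dots> < \<infinity>"
    using f by (simp add: integrable_iff_bounded M.emeasure_space_1)
  finally show "(\<integral>\<^sup>+p. ennreal (norm (case p of (x, y) \<Rightarrow> f (x * y))) \<partial>(haar \<Otimes>\<^sub>M \<mu>)) < \<infinity>" .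
qed

lemma integrable_markov_op:
  fixes f :: "complex \<Rightarrow> complex"
  assumes \<mu>: "circle_prob \<mu>" and f: "integrable haar f"
  shows "integrable haar (markov_op \<mu> f)"
proof -
  interpret M: prob_space \<mu> by (rule circle_probD[OF \<mu>])
  interpret H: prob_space haar by (rule prob_space_haar)
  interpret P: pair_prob_space haar \<mu> ..
  show ?thesis unfolding markov_op_def
    using P.integrable_fst'[OF integrable_translate_pair[OF assms]] by simp
qed

lemma norm_markov_op_le:
  fixes g :: "complex \<Rightarrow> complex"
  assumes \<mu>: "circle_prob \<mu>" and B: "\<And>x. norm (g x) \<le> B"
  shows "norm (markov_op \<mu> g x) \<le> B"
proof -
  interpret M: prob_space \<mu> by (rule circle_probD[OF \<mu>])
  have B0: "0 \<le> B" using norm_ge_zero B order_trans by blast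
  show ?thesis
  proof (cases "integrable \<mu> (\<lambda>y. g (x * y))")
    case True
    have "norm (markov_op \<mu> g x) \<le> (\<integral>y. norm (g (x * y)) \<partial>\<mu>)"
      unfolding markov_op_def by (rule integral_norm_bound)
    also have "\<dots> \<le> (\<integral>y. B \<partial>\<mu>)" using True B by (intro integral_mono) auto
    finally show ?thesis by (simp add: M.prob_space)
  qed (simp add: markov_op_def not_integrable_integral_eq B0)
qed

text \<open>
  Interchange the integrals over \<open>x\<close> and \<open>y\<close>, and for fixed \<open>y\<close> replace \<open>x\<close> by \<open>x * inverse y\<close>: the
  product \<open>f (x * y) * g (inverse x)\<close> becomes \<open>f x * g (inverse x * y)\<close>. Commutativity of the group
  is what lets \<open>y\<close> move to the other argument without changing the operator.
\<close>

lemma markov_op_symmetric: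
  fixes f g :: "complex \<Rightarrow> complex"
  assumes \<mu>: "circle_prob \<mu>" and f: "integrable haar f"
    and g [measurable]: "g \<in> borel_measurable circle_borel" and B: "\<And>x. norm (g x) \<le> B"
  shows "(\<integral>x. markov_op \<mu> f x * g (inverse x) \<partial>haar) = (\<integral>x. f x * markov_op \<mu> g (inverse x) \<partial>haar)"
proof -
  interpret M: prob_space \<mu> by (rule circle_probD[OF \<mu>])
  interpret H: prob_space haar by (rule prob_space_haar)
  interpret P: pair_prob_space haar \<mu> ..
  note [measurable_cong] = circle_probD(2)[OF \<mu>]
  have f' [measurable]: "f \<in> borel_measurable circle_borel" using borel_measurable_integrable[OF f] by simp
  have B0: "0 \<le> B" using norm_ge_zero B order_trans by blast
  let ?h = "\<lambda>x y. f (x * y) * g (inverse x)" and ?k = "\<lambda>x y. f x * g (inverse x * y)"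
  have jm [measurable]: "(\<lambda>(x, y). f (x * y)) \<in> borel_measurable (haar \<Otimes>\<^sub>M \<mu>)"
    using borel_measurable_integrable[OF integrable_translate_pair[OF \<mu> f]] .
  have "(\<lambda>p. (inverse (fst p), snd p)) \<in> measurable (haar \<Otimes>\<^sub>M \<mu>) (circle_borel \<Otimes>\<^sub>M \<mu>)" by measurable
  from measurable_compose[OF this measurable_circle_joint[OF \<mu> g]]
  have km [measurable]: "(\<lambda>(x, y). g (inverse x * y)) \<in> borel_measurable (haar \<Otimes>\<^sub>M \<mu>)"
    by (simp add: case_prod_beta')
  have ih: "integrable (haar \<Otimes>\<^sub>M \<mu>) (case_prod ?h)"
  proof (rule Bochner_Integration.integrable_bound[OF integrable_mult_right[OF integrable_translate_pair[OF \<mu> f], of "of_real B"]])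
    show "AE p in haar \<Otimes>\<^sub>M \<mu>. norm (case_prod ?h p) \<le> norm (of_real B * (case p of (x, y) \<Rightarrow> f (x * y)))"
      using B B0 by (intro AE_I2) (auto simp: norm_mult mult.commute[of B] intro!: mult_left_mono)
    have "case_prod ?h = (\<lambda>p. (case p of (x, y) \<Rightarrow> f (x * y)) * g (inverse (fst p)))" by auto
    then show "case_prod ?h \<in> borel_measurable (haar \<Otimes>\<^sub>M \<mu>)" by simp
  qed
  have "integrable (haar \<Otimes>\<^sub>M \<mu>) (\<lambda>p. f (fst p))"
  proof (rule integrableI_bounded)
    have "(\<integral>\<^sup>+p. ennreal (norm (f (fst p))) \<partial>(haar \<Otimes>\<^sub>M \<mu>)) = (\<integral>\<^sup>+x. ennreal (norm (f x)) \<partial>haar)"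
      by (subst M.nn_integral_fst[symmetric]) (auto simp: M.emeasure_space_1)
    then show "(\<integral>\<^sup>+p. ennreal (norm (f (fst p))) \<partial>(haar \<Otimes>\<^sub>M \<mu>)) < \<infinity>"
      using f by (simp add: integrable_iff_bounded)
  qed measurable
  note ff = this
  have ik: "integrable (haar \<Otimes>\<^sub>M \<mu>) (case_prod ?k)"
  proof (rule Bochner_Integration.integrable_bound[OF integrable_mult_right[OF ff, of "of_real B"]])
    show "AE p in haar \<Otimes>\<^sub>M \<mu>. norm (case_prod ?k p) \<le> norm (of_real B * f (fst p))"
      using B B0 by (intro AE_I2) (auto simp: norm_mult mult.commute[of B] intro!: mult_left_mono)
    have "case_prod ?k = (\<lambda>p. f (fst p) * (case p of (x, y) \<Rightarrow> g (inverse x * y)))" by auto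
    then show "case_prod ?k \<in> borel_measurable (haar \<Otimes>\<^sub>M \<mu>)" by simp
  qed
  have "(\<integral>x. markov_op \<mu> f x * g (inverse x) \<partial>haar) = (\<integral>x. \<integral>y. ?h x y \<partial>\<mu> \<partial>haar)"
    by (simp add: markov_op_def)
  also have "\<dots> = (\<integral>y. \<integral>x. ?h x y \<partial>haar \<partial>\<mu>)"
    by (rule P.Fubini_integral[OF ih, symmetric])
  also have "\<dots> = (\<integral>y. \<integral>x. ?k x y \<partial>haar \<partial>\<mu>)"
  proof (rule Bochner_Integration.integral_cong)
    fix y assume "y \<in> space \<mu>"
    then have y: "y \<in> sphere 0 1" by (simp add: circle_probD[OF \<mu>])
    note [measurable] = measurable_circle_mult_left[OF y]
    have y0: "y \<noteq> 0" using y by auto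
    have "(\<lambda>x. g (inverse x * y)) \<in> borel_measurable circle_borel"
      using measurable_compose[OF measurable_circle_inverse measurable_compose[OF measurable_circle_mult_left[OF y] g]]
      by (simp add: mult.commute)
    then have [measurable]: "(\<lambda>x. ?k x y) \<in> borel_measurable circle_borel" by measurable
    have "(\<integral>x. ?k x y \<partial>haar) = (\<integral>x. ?k x y \<partial>distr haar circle_borel (\<lambda>x. y * x))"
      by (simp add: distr_haar_mult[OF y])
    also have "\<dots> = (\<integral>x. ?k (y * x) y \<partial>haar)"
      by (rule integral_distr) auto
    also have "\<dots> = (\<integral>x. ?h x y \<partial>haar)"
    proof (rule Bochner_Integration.integral_cong)
      fix x
      have "inverse (y * x) * y = inverse x" using y0 by (simp add: field_simps)
      then show "?k (y * x) y = ?h x y" by (simp only: mult.commute[of x y])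
    qed simp
    finally show "(\<integral>x. ?h x y \<partial>haar) = (\<integral>x. ?k x y \<partial>haar)" ..
  qed simp
  also have "\<dots> = (\<integral>x. \<integral>y. ?k x y \<partial>\<mu> \<partial>haar)"
    by (rule P.Fubini_integral[OF ik])
  also have "\<dots> = (\<integral>x. f x * markov_op \<mu> g (inverse x) \<partial>haar)"
    by (simp add: markov_op_def)
  finally show ?thesis .
qed

lemma borel_measurable_markov_op_power:
  fixes f :: "complex \<Rightarrow> complex"
  assumes "circle_prob \<mu>" "f \<in> borel_measurable circle_borel"
  shows "(markov_op \<mu> ^^ n) f \<in> borel_measurable circle_borel"
  by (induction n) (auto intro: assms borel_measurable_markov_op)

lemma integrable_markov_op_power:
  fixes f :: "complex \<Rightarrow> complex"
  assumes "circle_prob \<mu>" "integrable haar f"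
  shows "integrable haar ((markov_op \<mu> ^^ n) f)"
  by (induction n) (auto intro: assms integrable_markov_op)

lemma markov_op_power_symmetric:
  fixes f g :: "complex \<Rightarrow> complex"
  assumes \<mu>: "circle_prob \<mu>" and f: "integrable haar f"
    and g: "g \<in> borel_measurable circle_borel" and B: "\<And>x. norm (g x) \<le> B"
  shows "(\<integral>x. (markov_op \<mu> ^^ n) f x * g (inverse x) \<partial>haar) = (\<integral>x. f x * (markov_op \<mu> ^^ n) g (inverse x) \<partial>haar)"
  using g B
proof (induction n arbitrary: g)
  case (Suc n)
  have "(\<integral>x. (markov_op \<mu> ^^ Suc n) f x * g (inverse x) \<partial>haar) = (\<integral>x. (markov_op \<mu> ^^ n) f x * markov_op \<mu> g (inverse x) \<partial>haar)"
    using markov_op_symmetric[OF \<mu> integrable_markov_op_power[OF \<mu> f] Suc.prems] by simp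
  also have "\<dots> = (\<integral>x. f x * (markov_op \<mu> ^^ n) (markov_op \<mu> g) (inverse x) \<partial>haar)"
    by (intro Suc.IH borel_measurable_markov_op norm_markov_op_le \<mu> Suc.prems)
  finally show ?case by (simp add: funpow_swap1)
qed simp

text \<open>
  Pairing \<open>mean_op f\<close> with \<open>g\<close> gives the product of the means of \<open>f\<close> and \<open>g\<close>, because inversion
  preserves Haar measure; hence the mean operator is symmetric too.
\<close>

lemma reflection_symmetric_markov_minus_mean:
  assumes \<mu>: "circle_prob \<mu>"
  shows "reflection_symmetric (\<lambda>f x. (markov_op \<mu> ^^ n) f x - mean_op f x)"
proof
  interpret H: prob_space haar by (rule prob_space_haar)
  fix f :: "complex \<Rightarrow> complex"
  {
    assume "f \<in> borel_measurable circle_borel"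
    from borel_measurable_markov_op_power[OF \<mu> this]
    show "(\<lambda>x. (markov_op \<mu> ^^ n) f x - mean_op f x) \<in> borel_measurable circle_borel"
      unfolding mean_op_def by measurable
  }
  assume f: "integrable haar f"
  then show "integrable haar (\<lambda>x. (markov_op \<mu> ^^ n) f x - mean_op f x)"
    unfolding mean_op_def by (intro Bochner_Integration.integrable_diff integrable_markov_op_power \<mu>) auto
  fix g :: "complex \<Rightarrow> complex" and B
  assume g [measurable]: "g \<in> borel_measurable circle_borel" and B: "\<And>x. norm (g x) \<le> B"
  let ?P = "markov_op \<mu> ^^ n"
  have Pg [measurable]: "?P g \<in> borel_measurable circle_borel" by (rule borel_measurable_markov_op_power[OF \<mu> g])
  have PB: "norm (?P g x) \<le> B" for x
    using B by (induction n arbitrary: x) (auto intro: norm_markov_op_le[OF \<mu>])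
  have bounded_mult: "integrable haar (\<lambda>x. u x * h (inverse x))"
    if u: "integrable haar u" and [measurable]: "h \<in> borel_measurable circle_borel" and hB: "\<And>x. norm (h x) \<le> B" for u h :: "complex \<Rightarrow> complex"
  proof (rule Bochner_Integration.integrable_bound[OF integrable_mult_right[OF u, of "of_real B"]])
    have "u \<in> borel_measurable circle_borel" using borel_measurable_integrable[OF u] by simp
    then show "(\<lambda>x. u x * h (inverse x)) \<in> borel_measurable haar" by measurable
    have "0 \<le> B" using norm_ge_zero B order_trans by blast
    then show "AE x in haar. norm (u x * h (inverse x)) \<le> norm (complex_of_real B * u x)"
      using hB by (intro AE_I2) (auto simp: norm_mult mult.commute[of B] intro!: mult_left_mono)
  qed
  have mean_inverse: "(\<integral>x. g (inverse x) \<partial>haar) = (\<integral>x. g x \<partial>haar)"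
  proof -
    have "(\<integral>x. g x \<partial>distr haar circle_borel inverse) = (\<integral>x. g (inverse x) \<partial>haar)"
      by (rule integral_distr) auto
    then show ?thesis by (simp add: distr_haar_inverse)
  qed
  have ig: "integrable haar (\<lambda>x. g (inverse x))"
    using bounded_mult[of "\<lambda>_. 1", OF _ g B] by simp
  have "(\<integral>x. (?P f x - mean_op f x) * g (inverse x) \<partial>haar)
      = (\<integral>x. ?P f x * g (inverse x) \<partial>haar) - (\<integral>x. f x \<partial>haar) * (\<integral>x. g (inverse x) \<partial>haar)"
    using ig bounded_mult[OF integrable_markov_op_power[OF \<mu> f] g B]
    by (simp add: left_diff_distrib mean_op_def)
  also have "\<dots> = (\<integral>x. f x * ?P g (inverse x) \<partial>haar) - (\<integral>x. f x \<partial>haar) * (\<integral>x. g x \<partial>haar)"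
    by (simp add: markov_op_power_symmetric[OF \<mu> f g B] mean_inverse)
  also have "\<dots> = (\<integral>x. f x * (?P g (inverse x) - mean_op g (inverse x)) \<partial>haar)"
    using f bounded_mult[OF f Pg PB]
    by (simp add: right_diff_distrib mean_op_def)
  finally show "(\<integral>x. (?P f x - mean_op f x) * g (inverse x) \<partial>haar) = (\<integral>x. f x * (?P g (inverse x) - mean_op g (inverse x)) \<partial>haar)" .
qed

theorem corollary2p5:
  fixes \<mu> :: "complex measure"
  assumes "circle_prob \<mu>" and "adapted \<mu>"
  shows "(doeblin (markov_op \<mu>) \<longleftrightarrow> (\<exists>k\<ge>1. nonsingular (conv_power \<mu> k))) \<and>
         (doeblin (markov_op \<mu>) \<longleftrightarrow> doeblin (dual_markov_op \<mu>)) \<and>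
         (((\<lambda>n. Lp_op_norm \<infinity> (\<lambda>f x. (markov_op \<mu> ^^ n) f x - mean_op f x)) \<longlonglongrightarrow> 0) \<longleftrightarrow>
          ((\<lambda>n. Lp_op_norm 1 (\<lambda>f x. (markov_op \<mu> ^^ n) f x - mean_op f x)) \<longlonglongrightarrow> 0))"
proof -
  interpret reflection_symmetric "\<lambda>f x. (markov_op \<mu> ^^ n) f x - mean_op f x" for n
    by (rule reflection_symmetric_markov_minus_mean[OF assms(1)])
  have norms: "Lp_op_norm \<infinity> (\<lambda>f x. (markov_op \<mu> ^^ n) f x - mean_op f x)
      = Lp_op_norm 1 (\<lambda>f x. (markov_op \<mu> ^^ n) f x - mean_op f x)" for n
    by (rule op_norm_infinity_eq_1)
  show ?thesis
    unfolding norms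
    using doeblin_iff_nonsingular_power[OF assms(1)] doeblin_dual_markov_op_iff[OF assms(1)] by blast
qed

end
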